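(* For every finite relational language $L$, the class $\mathrm{TO}(L)$ of all (finite) structures $\mathrm{TO}(\vec{\mathbf A})$, where $\vec{\mathbf A}$ ranges over finite totally ordered $L$-structures, is a Ramsey class.
   Context: A totally ordered $L$-structure $\vec{\mathbf A}$ is a relational $L$-structure $\mathbf A$ (vertex set $A$, relations $R_{\mathbf A}\subseteq A^{a}$ for each $R\in L$ of arity $a$) together with a linear order $\leq_{\mathbf A}$ of $A$ and, for every $R\in L$, a linear order $\leq^{R}_{\mathbf A}$ of the set of tuples $R_{\mathbf A}$. No relationship between these orders is assumed. $\mathrm{TO}(\vec{\mathbf A})$ is the relational structure on vertex set $A$ with the relations $R_{\mathbf A}$ ($R\in L$), the binary relation $\leq_{\mathbf A}$, and, for every $R\in L$ of arity $a$, the relation $R^{\leq}_{\mathbf A}$ of arity $2a$ given by $(x_1,\dots,x_a,y_1,\dots,y_a)\in R^{\leq}_{\mathbf A}$ iff $(x_1,\dots,x_a)\leq^{R}_{\mathbf A}(y_1,\dots,y_a)$. Embeddings of such structures are the usual embeddings of relational structures (injections preserving and reflecting all relations), and substructures are induced substructures. $\binom{\mathbf B}{\mathbf A}$ is the set of substructures of $\mathbf B$ isomorphic to $\mathbf A$. A class $\mathcal C$ of finite structures is Ramsey if for all $\mathbf A,\mathbf B\in\mathcal C$ and $k\ge1$ there is $\mathbf C\in\mathcal C$ such that for every partition of $\binom{\mathbf C}{\mathbf A}$ into $k$ classes there is $\widetilde{\mathbf B}\in\binom{\mathbf C}{\mathbf B}$ with $\binom{\widetilde{\mathbf B}}{\mathbf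 A}$ contained in one class. *)

theory Defs
  imports Main "HOL-Library.Infinite_Typeclass" "HOL-Library.Disjoint_Sets"
begin

text \<open>
  A relational language is a set \<open>L\<close> of symbols with an arity function \<open>ar\<close>; a tuple is a list.
  Symbols of the type \<open>'r\<close> that are not in \<open>L\<close> are interpreted by the empty relation, so that
  equality of records is equality of \<open>L\<close>-structures, and embeddings and substructures need not
  mention \<open>L\<close>.
\<close>

record ('v, 'r) rel_structure =
  verts :: "'v set"
  rel :: "'r \<Rightarrow> 'v list set"

definition is_structure ::
    "'r set \<Rightarrow> ('r \<Rightarrow> nat) \<Rightarrow> ('v, 'r, 'm) rel_structure_scheme \<Rightarrow> bool" where
  "is_structure L ar A \<longleftrightarrow>
     (\<forall>R\<in>L. rel A R \<subseteq> {xs. set xs \<subseteq> verts A \<and> length xs = ar R}) \<and>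
     (\<forall>R. R \<notin> L \<longrightarrow> rel A R = {})"

definition embedding ::
    "('v \<Rightarrow> 'w) \<Rightarrow> ('v, 'r) rel_structure \<Rightarrow> ('w, 'r) rel_structure \<Rightarrow> bool" where
  "embedding f A B \<longleftrightarrow>
     inj_on f (verts A) \<and> f ` verts A \<subseteq> verts B \<and>
     (\<forall>R xs. set xs \<subseteq> verts A \<longrightarrow> (xs \<in> rel A R \<longleftrightarrow> map f xs \<in> rel B R))"

definition isomorphic ::
    "('v, 'r) rel_structure \<Rightarrow> ('w, 'r) rel_structure \<Rightarrow> bool" where
  "isomorphic A B \<longleftrightarrow> (\<exists>f. embedding f A B \<and> f ` verts A = verts B)"

definition substructure ::
    "('v, 'r) rel_structure \<Rightarrow> ('v, 'r) rel_structure \<Rightarrow> bool" where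
  "substructure A B \<longleftrightarrow>
     verts A \<subseteq> verts B \<and> (\<forall>R. rel A R = {xs \<in> rel B R. set xs \<subseteq> verts A})"

definition copies ::
    "('v, 'r) rel_structure \<Rightarrow> ('v, 'r) rel_structure \<Rightarrow> ('v, 'r) rel_structure set" where
  "copies B A = {A'. substructure A' B \<and> isomorphic A' A}"

text \<open>
  A partition into \<open>k\<close> classes is an indexed disjoint family \<open>P 0, \<dots>, P (k - 1)\<close>, in which
  classes may be empty: otherwise a \<open>C\<close> with fewer than \<open>k\<close> copies of \<open>A\<close> would satisfy
  the condition vacuously.
\<close>

definition ramsey_class :: "('v, 'r) rel_structure set \<Rightarrow> bool" where
  "ramsey_class K \<longleftrightarrow>
     (\<forall>A\<in>K. \<forall>B\<in>K. \<forall>k\<ge>1. \<exists>C\<in>K.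
        \<forall>P :: nat \<Rightarrow> ('v, 'r) rel_structure set.
          disjoint_family_on P {..<k} \<and> (\<Union>i<k. P i) = copies C A \<longrightarrow>
          (\<exists>B'\<in>copies C B. \<exists>i<k. copies B' A \<subseteq> P i))"

record ('v, 'r) ordered_structure = "('v, 'r) rel_structure" +
  vert_le :: "('v \<times> 'v) set"
  tuple_le :: "'r \<Rightarrow> ('v list \<times> 'v list) set"

definition totally_ordered_structure ::
    "'r set \<Rightarrow> ('r \<Rightarrow> nat) \<Rightarrow> ('v, 'r) ordered_structure \<Rightarrow> bool" where
  "totally_ordered_structure L ar A \<longleftrightarrow>
     is_structure L ar A \<and>
     linear_order_on (verts A) (vert_le A) \<and>
     (\<forall>R\<in>L. linear_order_on (rel A R) (tuple_le A R)) \<and>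
     (\<forall>R. R \<notin> L \<longrightarrow> tuple_le A R = {})"

datatype 'r TO_symbol = Rel 'r | Vert_Le | Tuple_Le 'r

definition TO_language :: "'r set \<Rightarrow> 'r TO_symbol set" where
  "TO_language L = Rel ` L \<union> {Vert_Le} \<union> Tuple_Le ` L"

primrec TO_arity :: "('r \<Rightarrow> nat) \<Rightarrow> 'r TO_symbol \<Rightarrow> nat" where
  "TO_arity ar (Rel R) = ar R"
| "TO_arity ar Vert_Le = 2"
| "TO_arity ar (Tuple_Le R) = 2 * ar R"

primrec TO_rel :: "('v, 'r) ordered_structure \<Rightarrow> 'r TO_symbol \<Rightarrow> 'v list set" where
  "TO_rel A (Rel R) = rel A R"
| "TO_rel A Vert_Le = {[x, y] | x y. (x, y) \<in> vert_le A}"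
| "TO_rel A (Tuple_Le R) = {xs @ ys | xs ys. (xs, ys) \<in> tuple_le A R}"

definition TO :: "('v, 'r) ordered_structure \<Rightarrow> ('v, 'r TO_symbol) rel_structure" where
  "TO A = \<lparr>verts = verts A, rel = TO_rel A\<rparr>"

definition TO_class ::
    "'r set \<Rightarrow> ('r \<Rightarrow> nat) \<Rightarrow> ('v, 'r TO_symbol) rel_structure set" where
  "TO_class L ar = {TO A | A. totally_ordered_structure L ar A \<and> finite (verts A)}"

lemma is_structure_TO:
  assumes "totally_ordered_structure L ar A"
  shows "is_structure (TO_language L) (TO_arity ar) (TO A)"
proof -
  have rel_A: "set xs \<subseteq> verts A" "length xs = ar R" if "R \<in> L" "xs \<in> rel A R" for R xs
    using assms that by (auto simp: totally_ordered_structure_def is_structure_def)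
  have vert: "vert_le A \<subseteq> verts A \<times> verts A"
    using assms by (auto simp: totally_ordered_structure_def order_on_defs)
  have tuple: "xs \<in> rel A R" "ys \<in> rel A R" if "R \<in> L" "(xs, ys) \<in> tuple_le A R" for R xs ys
    using assms that by (auto simp: totally_ordered_structure_def order_on_defs)
  have outside: "rel A R = {}" "tuple_le A R = {}" if "R \<notin> L" for R
    using assms that by (auto simp: totally_ordered_structure_def is_structure_def)
  have "TO_rel A S \<subseteq> {xs. set xs \<subseteq> verts A \<and> length xs = TO_arity ar S}"
    if "S \<in> TO_language L" for S
  proof (cases S)
    case (Rel R)
    with that show ?thesis by (auto simp: TO_language_def dest: rel_A)
  next
    case Vert_Le
    with vert show ?thesis by auto
  next
    case (Tuple_Le R)
    with that have R: "R \<in> L" by (auto simp: TO_language_def)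
    have "set (xs @ ys) \<subseteq> verts A \<and> length (xs @ ys) = 2 * ar R"
      if "(xs, ys) \<in> tuple_le A R" for xs ys
      using rel_A[OF R tuple(1)[OF R that]] rel_A[OF R tuple(2)[OF R that]] by simp
    with Tuple_Le show ?thesis by fastforce
  qed
  moreover have "TO_rel A S = {}" if "S \<notin> TO_language L" for S
    using that by (cases S) (auto simp: TO_language_def image_iff outside)
  ultimately show ?thesis by (auto simp: is_structure_def TO_def)
qed

end

theory Submission
  imports Defs "HOL-Library.Ramsey"
begin

text \<open>
  An order on the tuples of a relation turns the tuples into points that have to be placed, exactly
  as the vertex order does for the vertices. So the vertices (as one-element tuples) and the
  nonempty tuples of all relations of a totally ordered structure \<open>A\<close> are collected into one finite
  linearly ordered set \<open>points A\<close>: sort by sort, where the vertices form one sort and each relation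
  another, and inside a sort by the given order. A strictly increasing map \<open>\<kappa>\<close> from \<open>points A\<close> to the
  naturals replaces the orders by labels: \<open>labelled A \<kappa>\<close> is an unordered relational structure with
  one symbol \<open>(s, i)\<close> for each sort \<open>s\<close> and each label \<open>i\<close>. Two facts make this useful. Distinct points of \<open>A\<close> have
  distinct labels, so a map that preserves labels preserves all orders, as soon as the orders of the
  target refine the order of the labels (\<open>realises_embedding\<close>). And \<open>\<kappa>\<close> is determined by
  its image (\<open>labelling_unique\<close>), so the labellings of \<open>A\<close> are sets of naturals of the fixed size
  \<open>card (points A)\<close>.

  The Ramsey property now splits into two parts. Ramsey's theorem gives an \<open>N\<close> such that every
  \<open>k\<close>-colouring of the \<open>card (points A)\<close>-subsets of \<open>{..<N}\<close> is constant on those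
  subsets of some set of size \<open>card (points B)\<close>. It remains to find a labelled structure in which the colour of a copy of \<open>A\<close>
  depends only on its labels. This is the partite construction of Nesetril and Rodl. It starts
  with the disjoint union \<open>Q\<close> of all \<open>labelled B \<kappa>\<close> with labels below \<open>N\<close>, and enlarges it once for
  each labelling of \<open>A\<close>. One enlargement (\<open>partite_lemma\<close>) takes the transversal copies of
  \<open>A\<close> in \<open>Q\<close> as the alphabet of the Hales--Jewett theorem and glues together one copy of \<open>Q\<close> for
  each combinatorial line. A homogeneous line yields a copy of \<open>Q\<close> in which all copies of \<open>A\<close> with
  the given labels have the same colour.

  Every structure that arises is covered by embedded copies of the structures it started with
  (\<open>covered_by\<close>). Hence every tuple of the final structure still has exactly one label in
  each sort that contains it, and ordering the
  tuples by label, with ties broken arbitrarily, turns it into the required totally ordered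
  structure.
\<close>

section \<open>The Hales--Jewett theorem\<close>

text \<open>
  A combinatorial line is encoded by a word in which the letter \<open>None\<close> marks the moving coordinates.
\<close>

definition fill :: "'a option list \<Rightarrow> 'a \<Rightarrow> 'a list" where
  "fill l a = map (case_option a id) l"

definition lines :: "'a set \<Rightarrow> nat \<Rightarrow> 'a option list set" where
  "lines S n = {l. set l \<subseteq> insert None (Some ` S) \<and> length l = n \<and> None \<in> set l}"

definition words :: "'a set \<Rightarrow> nat \<Rightarrow> 'a list set" where
  "words S n = {w. set w \<subseteq> S \<and> length w = n}"

lemma finite_words: "finite S \<Longrightarrow> finite (words S n)"
  by (simp add: words_def finite_lists_length_eq)

lemma finite_lines: "finite S \<Longrightarrow> finite (lines S n)"
  unfolding lines_def
  by (rule finite_subset[OF _ finite_lists_length_eq[of "insert None (Some ` S)" n]]) auto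

lemma fill_append: "fill (l @ l') a = fill l a @ fill l' a"
  by (simp add: fill_def)

lemma fill_constant: "fill (map Some w) a = w"
  by (induction w) (auto simp: fill_def)

lemma fill_in_words: "l \<in> lines S n \<Longrightarrow> a \<in> S \<Longrightarrow> fill l a \<in> words S n"
  by (auto simp: lines_def words_def fill_def split: option.split)

lemma lines_mono: "S \<subseteq> T \<Longrightarrow> lines S n \<subseteq> lines T n"
  by (auto simp: lines_def)

lemma lines_append:
  "l \<in> lines S m \<Longrightarrow> l' \<in> lines S n \<Longrightarrow> l @ l' \<in> lines S (m + n)"
  "l \<in> lines S m \<Longrightarrow> w \<in> words S n \<Longrightarrow> l @ map Some w \<in> lines S (m + n)"
  "w \<in> words S m \<Longrightarrow> l' \<in> lines S n \<Longrightarrow> map Some w @ l' \<in> lines S (m + n)"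
  by (auto simp: lines_def words_def)

lemma words_append: "v \<in> words S m \<Longrightarrow> w \<in> words S n \<Longrightarrow> v @ w \<in> words S (m + n)"
  by (auto simp: words_def)

definition hales_jewett_property :: "'a set \<Rightarrow> nat \<Rightarrow> nat \<Rightarrow> bool" where
  "hales_jewett_property S k n \<longleftrightarrow>
     (\<forall>\<chi>. \<chi> \<in> words S n \<rightarrow> {..<k} \<longrightarrow> (\<exists>l\<in>lines S n. \<exists>c. \<forall>a\<in>S. \<chi> (fill l a) = c))"

text \<open>
  The induction below colours words by whole colourings of other words, hence the need for an
  arbitrary finite set of colours.
\<close>

lemma hales_jewett_arbitrary_colours:
  assumes HJ: "\<And>k. \<exists>n. hales_jewett_property S k n" and "finite F"
  obtains n where "\<And>\<chi>. \<chi> \<in> words S n \<rightarrow> F \<Longrightarrow> \<exists>l\<in>lines S n. \<exists>c. \<forall>a\<in>S. \<chi> (fill l a) = c"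
proof -
  obtain h :: "'b \<Rightarrow> nat" where h: "bij_betw h F {0..<card F}"
    using ex_bij_betw_finite_nat[OF \<open>finite F\<close>] by blast
  obtain n where n: "hales_jewett_property S (card F) n" using HJ by blast
  show ?thesis
  proof
    fix \<chi> :: "'a list \<Rightarrow> 'b" assume \<chi>: "\<chi> \<in> words S n \<rightarrow> F"
    have "h (\<chi> w) < card F" if "w \<in> words S n" for w
      using bij_betwE[OF h] funcset_mem[OF \<chi> that] by simp
    then have "(\<lambda>w. h (\<chi> w)) \<in> words S n \<rightarrow> {..<card F}" by simp
    then obtain l c where l: "l \<in> lines S n" "\<forall>a\<in>S. h (\<chi> (fill l a)) = c"
      using n unfolding hales_jewett_property_def by blast
    have "\<chi> (fill l a) = inv_into F h c" if "a \<in> S" for a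
      using l(2) that bij_betw_inv_into_left[OF h funcset_mem[OF \<chi> fill_in_words[OF l(1) that]]]
      by simp
    then show "\<exists>l\<in>lines S n. \<exists>c. \<forall>a\<in>S. \<chi> (fill l a) = c" using l(1) by blast
  qed
qed

text \<open>
  Colour focusing: \<open>r\<close> lines of pairwise different colours, each monochromatic over \<open>S\<close>, which all
  pass through the same point when the moving letter is the new letter \<open>z\<close>. The set \<open>C\<close> collects the
  colours; indexing the lines by their colours avoids lists of lines.
\<close>

definition focused :: "'a set \<Rightarrow> 'a \<Rightarrow> nat \<Rightarrow> ('a list \<Rightarrow> nat) \<Rightarrow> nat \<Rightarrow> bool" where
  "focused S z n \<chi> r \<longleftrightarrow>
     (\<exists>f\<in>words (insert z S) n. \<exists>C. finite C \<and> card C = r \<and>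
        (\<forall>c\<in>C. \<exists>l\<in>lines (insert z S) n. fill l z = f \<and> (\<forall>a\<in>S. \<chi> (fill l a) = c)))"

text \<open>
  To go from \<open>r\<close> to \<open>Suc r\<close> lines, prefix the words of length \<open>n\<close> by words of a length \<open>m\<close> for which
  Hales--Jewett over \<open>S\<close> applies to colourings by functions on the words of length \<open>n\<close>. This gives a
  line \<open>l\<close> of prefixes over \<open>S\<close> that all induce the same colouring \<open>c\<close> of the suffixes. For \<open>c\<close> there are \<open>r\<close>
  focused lines with focus \<open>f\<close>. If \<open>c f\<close> is one of their colours, that line is monochromatic including \<open>z\<close>.
  Otherwise moving along \<open>l\<close> and each of the \<open>r\<close> lines simultaneously, together with moving along \<open>l\<close>
  alone with suffix \<open>f\<close>, yields \<open>Suc r\<close> focused lines.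
\<close>

lemma colour_focusing:
  fixes S :: "'a set" and z :: 'a
  assumes HJ: "\<And>k. \<exists>n. hales_jewett_property S k n" and fin: "finite S" and ne: "S \<noteq> {}"
  shows "\<exists>n. \<forall>\<chi>. \<chi> \<in> words (insert z S) n \<rightarrow> {..<k} \<longrightarrow>
     (\<exists>l\<in>lines (insert z S) n. \<exists>c. \<forall>a\<in>insert z S. \<chi> (fill l a) = c) \<or> focused S z n \<chi> r"
proof (induction r)
  case 0
  have "focused S z 0 \<chi> 0" for \<chi>
    unfolding focused_def by (intro bexI[of _ "[]"] exI[of _ "{}"]) (simp_all add: words_def)
  then show ?case by blast
next
  case (Suc r)
  let ?T = "insert z S"
  obtain n where n: "\<And>\<chi>. \<chi> \<in> words ?T n \<rightarrow> {..<k} \<Longrightarrow>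
     (\<exists>l\<in>lines ?T n. \<exists>c. \<forall>a\<in>?T. \<chi> (fill l a) = c) \<or> focused S z n \<chi> r"
    using Suc.IH by blast
  have "finite (words ?T n \<rightarrow>\<^sub>E {..<k})" using fin by (intro finite_PiE finite_words) auto
  then obtain m where m: "\<And>\<Phi>. \<Phi> \<in> words S m \<rightarrow> (words ?T n \<rightarrow>\<^sub>E {..<k}) \<Longrightarrow>
      \<exists>l\<in>lines S m. \<exists>c. \<forall>a\<in>S. \<Phi> (fill l a) = c"
    using hales_jewett_arbitrary_colours[of S, OF HJ] by blast
  have "(\<exists>l\<in>lines ?T (m + n). \<exists>c. \<forall>a\<in>?T. \<chi> (fill l a) = c) \<or> focused S z (m + n) \<chi> (Suc r)"
    if \<chi>: "\<chi> \<in> words ?T (m + n) \<rightarrow> {..<k}" for \<chi>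
  proof -
    define \<Phi> where "\<Phi> w = restrict (\<lambda>u. \<chi> (w @ u)) (words ?T n)" for w
    have sub: "words S m \<subseteq> words ?T m" by (auto simp: words_def)
    have "\<Phi> w \<in> words ?T n \<rightarrow>\<^sub>E {..<k}" if "w \<in> words S m" for w
      unfolding \<Phi>_def
      by (intro restrict_PiE_iff[THEN iffD2] ballI funcset_mem[OF \<chi>] words_append)
        (use sub that in auto)
    then have "\<Phi> \<in> words S m \<rightarrow> (words ?T n \<rightarrow>\<^sub>E {..<k})" by blast
    then obtain l c where l: "l \<in> lines S m" and c: "\<And>a. a \<in> S \<Longrightarrow> \<Phi> (fill l a) = c"
      using m by blast
    \<comment> \<open>Any letter of S represents the common colouring of the suffixes.\<close>
    obtain b where b: "b \<in> S" using ne by blast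
    have cb: "c u = \<chi> (fill l a @ u)" if "a \<in> S" "u \<in> words ?T n" for a u
      using c[OF that(1)] that(2) by (auto simp: \<Phi>_def)
    have lT: "l \<in> lines ?T m" using l lines_mono[of S ?T m] by auto
    have "c \<in> words ?T n \<rightarrow> {..<k}"
    proof
      fix u assume u: "u \<in> words ?T n"
      have "fill l b @ u \<in> words ?T (m + n)"
        using words_append[OF fill_in_words[OF lT] u] b by simp
      then show "c u \<in> {..<k}" using cb[OF b u] funcset_mem[OF \<chi>] by metis
    qed
    then consider
        (mono) l' d where "l' \<in> lines ?T n" "\<And>a. a \<in> ?T \<Longrightarrow> c (fill l' a) = d"
      | (foc) "focused S z n c r"
      using n by blast
    then show ?thesis
    proof cases
      case mono
      have "\<chi> (fill (map Some (fill l b) @ l') a) = d" if "a \<in> ?T" for a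
        using mono(2)[OF that] cb[OF b fill_in_words[OF mono(1) that]]
        by (simp add: fill_append fill_constant)
      moreover have "map Some (fill l b) @ l' \<in> lines ?T (m + n)"
        using lines_append(3)[OF fill_in_words[OF lT] mono(1)] b by simp
      ultimately show ?thesis by blast
    next
      case foc
      then obtain f C where f: "f \<in> words ?T n" and C: "finite C" "card C = r"
        and spokes: "\<And>d. d \<in> C \<Longrightarrow> \<exists>l'\<in>lines ?T n. fill l' z = f \<and> (\<forall>a\<in>S. c (fill l' a) = d)"
        unfolding focused_def by blast
      show ?thesis
      proof (cases "c f \<in> C")
        case True
        then obtain l' where l': "l' \<in> lines ?T n" "fill l' z = f" "\<forall>a\<in>S. c (fill l' a) = c f"
          using spokes by blast
        have "\<chi> (fill (map Some (fill l b) @ l') a) = c f" if "a \<in> ?T" for a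
          using l'(2,3) that cb[OF b fill_in_words[OF l'(1) that]]
          by (auto simp: fill_append fill_constant)
        moreover have "map Some (fill l b) @ l' \<in> lines ?T (m + n)"
          using lines_append(3)[OF fill_in_words[OF lT] l'(1)] b by simp
        ultimately show ?thesis by blast
      next
        case False
        \<comment> \<open>The colour of f itself belongs to the line that moves in the prefix only.\<close>
        have "\<exists>l''\<in>lines ?T (m + n). fill l'' z = fill l z @ f \<and> (\<forall>a\<in>S. \<chi> (fill l'' a) = d)"
          if d: "d \<in> insert (c f) C" for d
        proof (cases "d = c f")
          case True
          have "\<chi> (fill (l @ map Some f) a) = d" if "a \<in> S" for a
            using cb[OF that f] True by (simp add: fill_append fill_constant)
          moreover have "fill (l @ map Some f) z = fill l z @ f"
            by (simp add: fill_append fill_constant)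
          ultimately show ?thesis using lines_append(2)[OF lT f] by blast
        next
          case False
          then obtain l' where l': "l' \<in> lines ?T n" "fill l' z = f" "\<And>a. a \<in> S \<Longrightarrow> c (fill l' a) = d"
            using d spokes by blast
          have "\<chi> (fill (l @ l') a) = d" if "a \<in> S" for a
            using cb[OF that fill_in_words[OF l'(1)]] that l'(3) by (simp add: fill_append)
          moreover have "fill (l @ l') z = fill l z @ f"
            using l'(2) by (simp add: fill_append)
          ultimately show ?thesis using lines_append(1)[OF lT l'(1)] by blast
        qed
        moreover have "fill l z @ f \<in> words ?T (m + n)"
          using words_append[OF fill_in_words[OF lT] f] by simp
        moreover have "finite (insert (c f) C)" "card (insert (c f) C) = Suc r"
          using C False by auto
        ultimately show ?thesis unfolding focused_def by blast
      qed
    qed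
  qed
  then show ?case by blast
qed

text \<open>
  With \<open>k\<close> colours there cannot be \<open>Suc k\<close> focused lines, so colour focusing must end with a
  monochromatic line.
\<close>

lemma hales_jewett_nonempty:
  fixes S :: "'a set" and k :: nat
  assumes "finite S" "S \<noteq> {}"
  shows "\<exists>n. hales_jewett_property S k n"
  using assms
proof (induction S arbitrary: k rule: finite_ne_induct)
  case (singleton x)
  have "[None] \<in> lines {x} 1" by (simp add: lines_def)
  then show ?case unfolding hales_jewett_property_def by blast
next
  case (insert z S)
  obtain n where n: "\<And>\<chi>. \<chi> \<in> words (insert z S) n \<rightarrow> {..<k} \<Longrightarrow>
     (\<exists>l\<in>lines (insert z S) n. \<exists>c. \<forall>a\<in>insert z S. \<chi> (fill l a) = c) \<or> focused S z n \<chi> (Suc k)"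
    using colour_focusing[where S = S and z = z and k = k and r = "Suc k", OF insert.IH insert.hyps(1,2)]
    by blast
  have "\<not> focused S z n \<chi> (Suc k)" if \<chi>: "\<chi> \<in> words (insert z S) n \<rightarrow> {..<k}" for \<chi>
  proof
    assume "focused S z n \<chi> (Suc k)"
    then obtain C where C: "finite C" "card C = Suc k"
      and sp: "\<forall>c\<in>C. \<exists>l\<in>lines (insert z S) n. \<forall>a\<in>S. \<chi> (fill l a) = c"
      unfolding focused_def by (elim bexE exE conjE) meson
    obtain b where b: "b \<in> S" using insert.hyps by blast
    have "c < k" if "c \<in> C" for c
    proof -
      obtain l where l: "l \<in> lines (insert z S) n" "\<chi> (fill l b) = c" using sp \<open>c \<in> C\<close> b by blast
      have "fill l b \<in> words (insert z S) n" using fill_in_words[OF l(1)] b by simp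
      then show ?thesis using funcset_mem[OF \<chi>] l(2) by fastforce
    qed
    then have "C \<subseteq> {..<k}" by auto
    then show False using C card_mono[of "{..<k}" C] by simp
  qed
  then show ?case using n unfolding hales_jewett_property_def by blast
qed

text \<open>
  For an empty alphabet only the existence of a line is claimed; length \<open>1\<close> provides it.
\<close>

theorem hales_jewett:
  fixes S :: "'a set" and k :: nat
  assumes "finite S"
  shows "\<exists>n. hales_jewett_property S k n"
proof (cases "S = {}")
  case True
  have "[None] \<in> lines S 1" by (simp add: lines_def)
  then show ?thesis using True unfolding hales_jewett_property_def by blast
qed (use assms hales_jewett_nonempty in blast)

section \<open>Embeddings and coverings\<close>

lemma embedding_comp:
  assumes f: "embedding f A B" and g: "embedding g B C"
  shows "embedding (g \<circ> f) A C"
proof -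
  have sub: "f ` verts A \<subseteq> verts B" using f by (simp add: embedding_def)
  have "inj_on (g \<circ> f) (verts A)"
    using f g by (auto simp: embedding_def intro: comp_inj_on inj_on_subset)
  moreover have "(g \<circ> f) ` verts A \<subseteq> verts C"
    using sub g by (force simp: embedding_def)
  moreover have "xs \<in> rel A R \<longleftrightarrow> map (g \<circ> f) xs \<in> rel C R" if "set xs \<subseteq> verts A" for R xs
  proof -
    have "set (map f xs) \<subseteq> verts B" using that sub by auto
    then show ?thesis using f g that unfolding embedding_def by (metis map_map)
  qed
  ultimately show ?thesis by (simp add: embedding_def)
qed

lemma embedding_id: "embedding (\<lambda>v. v) A A"
  by (simp add: embedding_def)

lemma embedding_cong:
  assumes "\<And>a. a \<in> verts A \<Longrightarrow> f a = g a"
  shows "embedding f A B \<longleftrightarrow> embedding g A B"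
proof -
  have "map f xs \<in> rel B R \<longleftrightarrow> map g xs \<in> rel B R" if "set xs \<subseteq> verts A" for R xs
    using assms that by (metis map_eq_conv subsetD)
  moreover have "f ` verts A = g ` verts A" "inj_on f (verts A) = inj_on g (verts A)"
    using assms by (simp_all cong: inj_on_cong image_cong)
  ultimately show ?thesis by (simp add: embedding_def)
qed

lemma embedding_rel_iff:
  "embedding f A B \<Longrightarrow> set xs \<subseteq> verts A \<Longrightarrow> map f xs \<in> rel B R \<longleftrightarrow> xs \<in> rel A R"
  by (simp add: embedding_def)

lemma embedding_vert: "embedding f A B \<Longrightarrow> a \<in> verts A \<Longrightarrow> f a \<in> verts B"
  by (auto simp: embedding_def)

definition well_formed :: "('v, 's) rel_structure \<Rightarrow> bool" where
  "well_formed Q \<longleftrightarrow> (\<forall>R. \<forall>xs\<in>rel Q R. set xs \<subseteq> verts Q)"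

text \<open>
  All properties of the constructed structures that are needed later (arities, uniqueness of labels,
  uniqueness of parts) speak about one tuple or one vertex. They pass from \<open>K\<close> to \<open>Q\<close> along embeddings if
  every vertex and every tuple of \<open>Q\<close> lies in an embedded copy of a member of \<open>K\<close>.
\<close>

definition covered_by :: "('u, 's) rel_structure set \<Rightarrow> ('v, 's) rel_structure \<Rightarrow> bool" where
  "covered_by K Q \<longleftrightarrow>
     (\<forall>v\<in>verts Q. \<exists>M\<in>K. \<exists>e. embedding e M Q \<and> v \<in> e ` verts M) \<and>
     (\<forall>R. \<forall>xs\<in>rel Q R. \<exists>M\<in>K. \<exists>e us.
        embedding e M Q \<and> us \<in> rel M R \<and> set us \<subseteq> verts M \<and> xs = map e us)"

lemma covered_by_vertE:
  assumes "covered_by K Q" "v \<in> verts Q"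
  obtains M e u where "M \<in> K" "embedding e M Q" "u \<in> verts M" "v = e u"
  using assms unfolding covered_by_def by blast

lemma covered_by_relE:
  assumes "covered_by K Q" "xs \<in> rel Q R"
  obtains M e us where "M \<in> K" "embedding e M Q" "us \<in> rel M R" "set us \<subseteq> verts M" "xs = map e us"
  using assms unfolding covered_by_def by blast

lemma covered_by_well_formed:
  assumes "covered_by K Q"
  shows "well_formed Q"
  unfolding well_formed_def
proof (intro allI ballI)
  fix R xs assume "xs \<in> rel Q R"
  with assms show "set xs \<subseteq> verts Q"
    by (rule covered_by_relE) (auto simp: embedding_def)
qed

lemma covered_by_refl: "well_formed Q \<Longrightarrow> covered_by {Q} Q"
  unfolding covered_by_def well_formed_def using embedding_id[of Q] by force

lemma covered_by_trans:
  assumes KQ: "covered_by K Q" and Q: "covered_by {Q} Q'"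
  shows "covered_by K Q'"
  unfolding covered_by_def
proof (intro conjI ballI allI)
  fix v assume "v \<in> verts Q'"
  with Q obtain e u where e: "embedding e Q Q'" "u \<in> verts Q" "v = e u"
    by (rule covered_by_vertE) simp
  obtain M d w where M: "M \<in> K" "embedding d M Q" "w \<in> verts M" "u = d w"
    using KQ e(2) by (rule covered_by_vertE)
  show "\<exists>M\<in>K. \<exists>e. embedding e M Q' \<and> v \<in> e ` verts M"
    using M e(3) embedding_comp[OF M(2) e(1)] by (intro bexI[of _ M] exI[of _ "e \<circ> d"]) auto
next
  fix R xs assume "xs \<in> rel Q' R"
  with Q obtain e us where e: "embedding e Q Q'" "us \<in> rel Q R" "xs = map e us"
    by (rule covered_by_relE) simp
  obtain M d ws where M: "M \<in> K" "embedding d M Q" "ws \<in> rel M R" "set ws \<subseteq> verts M" "us = map d ws"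
    using KQ e(2) by (rule covered_by_relE)
  show "\<exists>M\<in>K. \<exists>e us. embedding e M Q' \<and> us \<in> rel M R \<and> set us \<subseteq> verts M \<and> xs = map e us"
    using M e(3) embedding_comp[OF M(2) e(1)]
    by (intro bexI[of _ M] exI[of _ "e \<circ> d"] exI[of _ ws]) auto
qed

text \<open>
  The constructions change the type of vertices; finite structures can be moved back into any
  infinite type.
\<close>

lemma exists_isomorphic_copy:
  fixes Q :: "('w, 's) rel_structure"
  assumes "finite (verts Q)" "well_formed Q"
  obtains Q' :: "('v::infinite, 's) rel_structure" and h
    where "finite (verts Q')" "covered_by {Q} Q'" "embedding h Q Q'"
proof -
  obtain h :: "'w \<Rightarrow> 'v" where h: "inj_on h (verts Q)"
    using arb_inj_on_finite_infinite[OF assms(1)] by blast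
  define Q' where "Q' = \<lparr>verts = h ` verts Q, rel = \<lambda>R. map h ` rel Q R\<rparr>"
  have "xs \<in> rel Q R" if xs: "set xs \<subseteq> verts Q" and im: "map h xs \<in> map h ` rel Q R" for R xs
  proof -
    obtain ys where ys: "ys \<in> rel Q R" "map h xs = map h ys" using im by blast
    have "set ys \<subseteq> verts Q" using ys(1) assms(2) by (auto simp: well_formed_def)
    then have "xs = ys"
      using ys(2) h xs by (metis inj_on_map_eq_map inj_on_subset Un_subset_iff)
    then show ?thesis using ys(1) by simp
  qed
  then have emb: "embedding h Q Q'" using h by (auto simp: embedding_def Q'_def)
  have "covered_by {Q} Q'"
    using emb assms(2) unfolding covered_by_def well_formed_def
    by (auto simp: Q'_def) blast
  moreover have "finite (verts Q')" using assms(1) by (simp add: Q'_def)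
  ultimately show ?thesis using that emb by blast
qed

section \<open>The partite construction\<close>

text \<open>
  \<open>U\<close> assigns to every vertex \<open>a\<close> of \<open>A\<close> a unary symbol that marks the part of \<open>a\<close>. The parts of different
  vertices are disjoint in \<open>Q\<close>, so \<open>Q\<close> restricted to these parts is an \<open>A\<close>-partite system and all embeddings
  of \<open>A\<close> into \<open>Q\<close> are transversal.
\<close>

definition distinguishes :: "('a \<Rightarrow> 's) \<Rightarrow> ('a, 's) rel_structure \<Rightarrow> ('v, 's) rel_structure \<Rightarrow> bool" where
  "distinguishes U A Q \<longleftrightarrow>
     (\<forall>a\<in>verts A. [a] \<in> rel A (U a)) \<and>
     (\<forall>v\<in>verts Q. \<forall>a\<in>verts A. \<forall>b\<in>verts A. [v] \<in> rel Q (U a) \<longrightarrow> [v] \<in> rel Q (U b) \<longrightarrow> a = b)"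

lemma distinguishes_covered:
  assumes "distinguishes U A Q" "covered_by {Q} Q'"
  shows "distinguishes U A Q'"
  unfolding distinguishes_def
proof (intro conjI ballI impI)
  show "[a] \<in> rel A (U a)" if "a \<in> verts A" for a
    using assms(1) that by (simp add: distinguishes_def)
  fix v a b assume v: "v \<in> verts Q'" and ab: "a \<in> verts A" "b \<in> verts A"
    and "[v] \<in> rel Q' (U a)" "[v] \<in> rel Q' (U b)"
  moreover obtain e u where e: "embedding e Q Q'" "u \<in> verts Q" "v = e u"
    using assms(2) v by (rule covered_by_vertE) simp
  ultimately have "[u] \<in> rel Q (U a)" "[u] \<in> rel Q (U b)"
    using embedding_rel_iff[OF e(1), of "[u]"] by auto
  then show "a = b" using assms(1) ab e(2) by (auto simp: distinguishes_def)
qed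

text \<open>
  A copy of \<open>A\<close> is coloured through its vertex set, which determines it as an induced
  substructure.
\<close>

definition copy_homogeneous ::
    "nat \<Rightarrow> ('a, 's) rel_structure \<Rightarrow> ('u, 's) rel_structure \<Rightarrow> ('v, 's) rel_structure \<Rightarrow> bool" where
  "copy_homogeneous k A Q Q' \<longleftrightarrow>
     (\<forall>\<chi>. (\<forall>S. \<chi> S < k) \<longrightarrow>
       (\<exists>e c. embedding e Q Q' \<and> (\<forall>f. embedding f A Q \<longrightarrow> \<chi> (e ` f ` verts A) = c)))"

text \<open>
  The alphabet \<open>\<Sigma>\<close> consists of the embeddings \<open>f\<close> of \<open>A\<close> into \<open>Q\<close>. For each line \<open>l\<close>, a vertex \<open>v\<close> in the part
  of \<open>a\<close> becomes the word with \<open>v\<close> at the moving coordinates and \<open>f a\<close> at the coordinates where \<open>l\<close> has the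
  letter \<open>f\<close>; vertices outside all parts are kept apart for different lines. The new structure is the
  union of the images of \<open>Q\<close> under these maps \<open>em l\<close>. A word of embeddings gives a set of \<open>n\<close>-letter words over
  the vertices, namely \<open>word_copy w\<close>, and \<open>em l\<close> sends the image of \<open>f\<close> to the set for the word \<open>fill l f\<close>. So a
  monochromatic line is an embedding of \<open>Q\<close> all of whose copies of \<open>A\<close> have one colour.

  The point is that each \<open>em l\<close> is an induced embedding, although tuples of different images
  overlap. Suppose \<open>em l\<close> maps the tuple \<open>us\<close> to the image under \<open>em l'\<close> of a tuple \<open>us'\<close> of \<open>Q\<close>. A common moving
  coordinate shows \<open>us = us'\<close>. Otherwise a coordinate at which only \<open>l\<close> moves shows that \<open>us\<close> lies in a copy of
  \<open>A\<close>, and a coordinate at which only \<open>l'\<close> moves shows that \<open>us'\<close> lies in another copy of \<open>A\<close>. Both tuples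
  correspond to the same tuple of \<open>A\<close>, so they satisfy the same relations.
\<close>

lemma partite_lemma:
  fixes A :: "('a, 's) rel_structure" and Q :: "('v, 's) rel_structure"
  assumes finA: "finite (verts A)" and finQ: "finite (verts Q)" and wf: "well_formed Q"
    and U: "distinguishes U A Q"
  obtains Q' :: "('v list + ('a \<Rightarrow> 'v) option list \<times> 'v, 's) rel_structure"
    where "finite (verts Q')" "covered_by {Q} Q'" "copy_homogeneous k A Q Q'"
proof -
  define over where "over v \<longleftrightarrow> (\<exists>a\<in>verts A. [v] \<in> rel Q (U a))" for v
  define part where "part v = (THE a. a \<in> verts A \<and> [v] \<in> rel Q (U a))" for v
  define \<Sigma> where "\<Sigma> = {f \<in> verts A \<rightarrow>\<^sub>E verts Q. embedding f A Q}"
  have part_eq: "part v = a" if "v \<in> verts Q" "a \<in> verts A" "[v] \<in> rel Q (U a)" for v a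
    unfolding part_def using that U by (intro the_equality) (auto simp: distinguishes_def)
  have part_in: "part v \<in> verts A" if "v \<in> verts Q" "over v" for v
    using that part_eq unfolding over_def by blast
  have emb_over: "over (f a)" "part (f a) = a" if f: "embedding f A Q" and a: "a \<in> verts A" for f a
  proof -
    have "[f a] \<in> rel Q (U a)"
      using embedding_rel_iff[OF f, of "[a]" "U a"] a U by (simp add: distinguishes_def)
    then show "over (f a)" "part (f a) = a"
      using a part_eq[OF embedding_vert[OF f a] a] by (auto simp: over_def)
  qed
  have finS: "finite \<Sigma>" unfolding \<Sigma>_def using finA finQ by (simp add: finite_PiE)
  then obtain n where HJ: "hales_jewett_property \<Sigma> k n" using hales_jewett by blast
  define co where "co v = case_option v (\<lambda>f::'a \<Rightarrow> 'v. f (part v))" for v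
  define em where "em l v = (if over v then Inl (map (co v) l) else Inr (l, v))" for l v
  define Q' where "Q' = \<lparr>verts = (\<Union>l\<in>lines \<Sigma> n. em l ` verts Q),
      rel = \<lambda>R. \<Union>l\<in>lines \<Sigma> n. map (em l) ` rel Q R\<rparr>"
  have moving: "\<exists>j<n. l ! j = None" if "l \<in> lines \<Sigma> n" for l
    using that by (auto simp: lines_def in_set_conv_nth)
  have letter: "f \<in> \<Sigma>" if "l \<in> lines \<Sigma> n" "j < n" "l ! j = Some f" for l j f
  proof -
    have "Some f \<in> set l" using that by (auto simp: lines_def in_set_conv_nth)
    then show ?thesis using that(1) by (auto simp: lines_def)
  qed
  have co_eq: "co u (l ! j) = co u' (l' ! j)"
    if "l \<in> lines \<Sigma> n" "l' \<in> lines \<Sigma> n" "em l u = em l' u'" "over u" "j < n" for l l' u u' j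
  proof -
    have "map (co u) l = map (co u') l'" using that by (auto simp: em_def split: if_splits)
    then have "map (co u) l ! j = map (co u') l' ! j" by simp
    then show ?thesis using that by (simp add: lines_def)
  qed
  have em_inj: "u = u'" if l: "l \<in> lines \<Sigma> n" and eq: "em l u = em l u'" for l u u'
  proof (cases "over u")
    case True
    obtain j where j: "j < n" "l ! j = None" using moving[OF l] by blast
    then show ?thesis using co_eq[OF l l eq True j(1)] by (simp add: co_def)
  next
    case False
    then show ?thesis using eq by (auto simp: em_def split: if_splits)
  qed
  \<comment> \<open>Images of different lines overlap, so em l could miss relations that another line adds.\<close>
  have reflect: "us \<in> rel Q R"
    if l: "l \<in> lines \<Sigma> n" and l': "l' \<in> lines \<Sigma> n" and us: "set us \<subseteq> verts Q"
      and us': "us' \<in> rel Q R" and eq: "map (em l) us = map (em l') us'" for l l' us us' R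
  proof -
    have us'Q: "set us' \<subseteq> verts Q" using us' wf by (auto simp: well_formed_def)
    have len: "length us = length us'" using eq by (metis length_map)
    have nth: "em l (us ! i) = em l' (us' ! i)" if "i < length us" for i
      using eq that len by (metis nth_map)
    have over_iff: "over (us ! i) \<longleftrightarrow> over (us' ! i)" if "i < length us" for i
      using nth[OF that] by (auto simp: em_def split: if_splits)
    have eqI: "us = us'" if "\<And>i. i < length us \<Longrightarrow> us ! i = us' ! i"
      using len that by (intro nth_equalityI) auto
    show ?thesis
    proof (cases "\<forall>i<length us. over (us ! i)")
      case False
      then obtain i where "i < length us" "\<not> over (us ! i)" by blast
      \<comment> \<open>A vertex outside the parts remembers the line it was placed by.\<close>
      then have "l = l'" using nth[of i] by (auto simp: em_def split: if_splits)
      then have "us = us'" using em_inj[OF l] nth by (intro eqI) simp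
      then show ?thesis using us' by simp
    next
      case True
      have co: "co (us ! i) (l ! j) = co (us' ! i) (l' ! j)" if "i < length us" "j < n" for i j
        using co_eq[OF l l' nth[OF that(1)]] True that by blast
      show ?thesis
      proof (cases "\<exists>j<n. l ! j = None \<and> l' ! j = None")
        case True
        then have "us = us'" using co by (intro eqI) (fastforce simp: co_def)
        then show ?thesis using us' by simp
      next
        case False
        obtain j f where j: "j < n" "l ! j = None" "l' ! j = Some f"
          using moving[OF l] False by (metis option.exhaust)
        obtain j' f' where j': "j' < n" "l' ! j' = None" "l ! j' = Some f'"
          using moving[OF l'] False by (metis option.exhaust)
        have f: "embedding f A Q" and f': "embedding f' A Q"
          using letter[OF l' j(1,3)] letter[OF l j'(1,3)] by (simp_all add: \<Sigma>_def)
        have *: "us ! i = f (part (us' ! i)) \<and> us' ! i = f' (part (us' ! i)) \<and> part (us' ! i) \<in> verts A"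
          if i: "i < length us" for i
        proof -
          have P: "part (us' ! i) \<in> verts A"
            using True over_iff i len us'Q by (intro part_in) auto
          have "us ! i = f (part (us' ! i))" using co[OF i j(1)] j by (simp add: co_def)
          moreover have "us' ! i = f' (part (us ! i))" using co[OF i j'(1)] j' by (simp add: co_def)
          ultimately show ?thesis using emb_over(2)[OF f P] P by simp
        qed
        have "us = map f (map part us')" "us' = map f' (map part us')"
          using * len by (auto intro!: nth_equalityI)
        moreover have "set (map part us') \<subseteq> verts A"
          using * len by (auto simp: in_set_conv_nth)
        ultimately show ?thesis using us' embedding_rel_iff[OF f] embedding_rel_iff[OF f'] by metis
      qed
    qed
  qed
  have emb: "embedding (em l) Q Q'" if l: "l \<in> lines \<Sigma> n" for l
    unfolding embedding_def
  proof (intro conjI allI impI)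
    show "inj_on (em l) (verts Q)" using em_inj[OF l] by (auto intro: inj_onI)
    show "em l ` verts Q \<subseteq> verts Q'" using l by (auto simp: Q'_def)
    fix R us assume us: "set us \<subseteq> verts Q"
    show "us \<in> rel Q R \<longleftrightarrow> map (em l) us \<in> rel Q' R"
      using reflect[OF l _ us] l by (auto simp: Q'_def)
  qed
  show ?thesis
  proof
    show "finite (verts Q')" using finQ finite_lines[OF finS] by (simp add: Q'_def)
    show "covered_by {Q} Q'"
      unfolding covered_by_def
    proof (intro conjI ballI allI)
      fix v assume "v \<in> verts Q'"
      then show "\<exists>M\<in>{Q}. \<exists>e. embedding e M Q' \<and> v \<in> e ` verts M"
        using emb unfolding Q'_def by auto
    next
      fix R xs assume "xs \<in> rel Q' R"
      then obtain l us where "l \<in> lines \<Sigma> n" "us \<in> rel Q R" "xs = map (em l) us"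
        unfolding Q'_def by auto
      then show "\<exists>M\<in>{Q}. \<exists>e us. embedding e M Q' \<and> us \<in> rel M R \<and> set us \<subseteq> verts M \<and> xs = map e us"
        using emb wf unfolding well_formed_def by blast
    qed
    show "copy_homogeneous k A Q Q'"
      unfolding copy_homogeneous_def
    proof (intro allI impI)
      fix \<chi> :: "('v list + ('a \<Rightarrow> 'v) option list \<times> 'v) set \<Rightarrow> nat"
      assume \<chi>: "\<forall>S. \<chi> S < k"
      define word_copy :: "('a \<Rightarrow> 'v) list \<Rightarrow> ('v list + ('a \<Rightarrow> 'v) option list \<times> 'v) set"
        where "word_copy w = (\<lambda>a. Inl (map (\<lambda>f. f a) w)) ` verts A" for w
      have "(\<lambda>w. \<chi> (word_copy w)) \<in> words \<Sigma> n \<rightarrow> {..<k}" using \<chi> by simp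
      then obtain l c where l: "l \<in> lines \<Sigma> n"
        and c: "\<And>f. f \<in> \<Sigma> \<Longrightarrow> \<chi> (word_copy (fill l f)) = c"
        using HJ unfolding hales_jewett_property_def by blast
      have "\<chi> (em l ` f ` verts A) = c" if f: "embedding f A Q" for f
      proof -
        \<comment> \<open>Letters are extensional functions so that the alphabet is finite.\<close>
        define g where "g = restrict f (verts A)"
        have g: "embedding g A Q" using f embedding_cong[of A f g Q] by (simp add: g_def)
        have fg: "f ` verts A = g ` verts A" by (auto simp: g_def)
        have "g \<in> \<Sigma>" using g embedding_vert[OF g] by (auto simp: \<Sigma>_def g_def)
        have "em l (g a) = Inl (map (\<lambda>f. f a) (fill l g))" if a: "a \<in> verts A" for a
          using emb_over[OF g a] by (auto simp: em_def co_def fill_def split: option.split)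
        then have "em l ` g ` verts A = word_copy (fill l g)"
          by (auto simp: word_copy_def image_image)
        then show ?thesis using c[OF \<open>g \<in> \<Sigma>\<close>] fg by simp
      qed
      then show "\<exists>e c. embedding e Q Q' \<and> (\<forall>f. embedding f A Q \<longrightarrow> \<chi> (e ` f ` verts A) = c)"
        using emb[OF l] by blast
    qed
  qed
qed

lemma copy_homogeneous_step:
  fixes A :: "('a, 's) rel_structure" and Q :: "('v::infinite, 's) rel_structure"
  assumes "finite (verts A)" "finite (verts Q)" "well_formed Q" "distinguishes U A Q"
  obtains Q' :: "('v, 's) rel_structure"
    where "finite (verts Q')" "covered_by {Q} Q'" "copy_homogeneous k A Q Q'"
proof -
  obtain P :: "('v list + ('a \<Rightarrow> 'v) option list \<times> 'v, 's) rel_structure"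
    where P: "finite (verts P)" "covered_by {Q} P" "copy_homogeneous k A Q P"
    using partite_lemma[OF assms] by blast
  obtain Q' :: "('v, 's) rel_structure" and h
    where Q': "finite (verts Q')" "covered_by {P} Q'" "embedding h P Q'"
    using exists_isomorphic_copy[OF P(1) covered_by_well_formed[OF P(2)]] by blast
  have "copy_homogeneous k A Q Q'"
    unfolding copy_homogeneous_def
  proof (intro allI impI)
    fix \<chi> :: "'v set \<Rightarrow> nat" assume "\<forall>S. \<chi> S < k"
    then have "\<forall>S. \<chi> (h ` S) < k" by simp
    then obtain e c where e: "embedding e Q P"
      "\<And>f. embedding f A Q \<Longrightarrow> \<chi> (h ` e ` f ` verts A) = c"
      using P(3)[unfolded copy_homogeneous_def, rule_format, of "\<lambda>S. \<chi> (h ` S)"] by blast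
    then show "\<exists>e c. embedding e Q Q' \<and> (\<forall>f. embedding f A Q \<longrightarrow> \<chi> (e ` f ` verts A) = c)"
      using embedding_comp[OF e(1) Q'(3)]
      by (intro exI[of _ "h \<circ> e"] exI[of _ c]) (auto simp: image_comp)
  qed
  then show ?thesis using that Q'(1) covered_by_trans[OF P(2) Q'(2)] by blast
qed

text \<open>
  Apply the one-step construction once per member of \<open>As\<close>. Later steps do not destroy what earlier ones
  achieved: a homogeneous copy of the previous structure is found first, and the colouring is pulled back to it.
\<close>

theorem partite_construction:
  fixes Q :: "('v::infinite, 's) rel_structure" and As :: "('a, 's) rel_structure set"
    and k :: nat
  assumes "finite As" "\<And>A. A \<in> As \<Longrightarrow> finite (verts A)" "finite (verts Q)" "well_formed Q"
    and "\<And>A. A \<in> As \<Longrightarrow> \<exists>U. distinguishes U A Q"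
  obtains Q' :: "('v, 's) rel_structure"
    where "finite (verts Q')" "covered_by {Q} Q'"
      "\<And>\<chi>. \<forall>S. \<chi> S < k \<Longrightarrow> \<exists>e. embedding e Q Q' \<and>
         (\<forall>A\<in>As. \<exists>c. \<forall>f. embedding f A Q \<longrightarrow> \<chi> (e ` f ` verts A) = c)"
proof -
  have "\<exists>Q' :: ('v, 's) rel_structure. finite (verts Q') \<and> covered_by {Q} Q' \<and>
      (\<forall>\<chi>. (\<forall>S. \<chi> S < k) \<longrightarrow> (\<exists>e. embedding e Q Q' \<and>
         (\<forall>A\<in>As. \<exists>c. \<forall>f. embedding f A Q \<longrightarrow> \<chi> (e ` f ` verts A) = c)))"
    using assms(1,2,5)
  proof (induction As rule: finite_induct)
    case empty
    then show ?case using assms(3,4) covered_by_refl embedding_id by blast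
  next
    case (insert A As)
    obtain P :: "('v, 's) rel_structure" where P: "finite (verts P)" "covered_by {Q} P"
      "\<And>\<chi>. \<forall>S. \<chi> S < k \<Longrightarrow> \<exists>e. embedding e Q P \<and>
         (\<forall>A\<in>As. \<exists>c. \<forall>f. embedding f A Q \<longrightarrow> \<chi> (e ` f ` verts A) = c)"
      using insert.IH insert.prems by (metis insertCI)
    obtain U where "distinguishes U A Q" using insert.prems by blast
    \<comment> \<open>P is the structure that is good for As; the step for A is applied on top of it.\<close>
    then have U: "distinguishes U A P" using P(2) by (rule distinguishes_covered)
    obtain Q' :: "('v, 's) rel_structure"
      where Q': "finite (verts Q')" "covered_by {P} Q'" "copy_homogeneous k A P Q'"
      using copy_homogeneous_step[OF _ P(1) covered_by_well_formed[OF P(2)] U] insert.prems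
      by blast
    have "\<exists>e. embedding e Q Q' \<and>
         (\<forall>A\<in>insert A As. \<exists>c. \<forall>f. embedding f A Q \<longrightarrow> \<chi> (e ` f ` verts A) = c)"
      if \<chi>: "\<forall>S. \<chi> S < k" for \<chi>
    proof -
      obtain d c where d: "embedding d P Q'"
        and c: "\<And>f. embedding f A P \<Longrightarrow> \<chi> (d ` f ` verts A) = c"
        using Q'(3) \<chi> unfolding copy_homogeneous_def by blast
      obtain e where e: "embedding e Q P"
        and As: "\<forall>A\<in>As. \<exists>c. \<forall>f. embedding f A Q \<longrightarrow> \<chi> (d ` e ` f ` verts A) = c"
        using P(3)[of "\<lambda>S. \<chi> (d ` S)"] \<chi> by blast
      have "\<chi> (d ` e ` f ` verts A) = c" if "embedding f A Q" for f
        using c[OF embedding_comp[OF that e]] by (simp add: image_comp)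
      then have "\<forall>A\<in>insert A As. \<exists>c. \<forall>f. embedding f A Q \<longrightarrow> \<chi> ((d \<circ> e) ` f ` verts A) = c"
        using As by (auto simp: image_comp)
      then show ?thesis using embedding_comp[OF e d] by blast
    qed
    then show ?case using Q'(1) covered_by_trans[OF P(2) Q'(2)] by blast
  qed
  then show ?thesis using that by blast
qed

text \<open>
  The empty tuple is common to all members of a disjoint union, so the members have to
  agree on the symbols that contain it.
\<close>

lemma disjoint_union:
  fixes K :: "('u, 's) rel_structure set"
  assumes "finite K" "\<And>M. M \<in> K \<Longrightarrow> finite (verts M)" "\<And>M. M \<in> K \<Longrightarrow> well_formed M"
    and nullary: "\<And>M M' R. M \<in> K \<Longrightarrow> M' \<in> K \<Longrightarrow> [] \<in> rel M R \<Longrightarrow> [] \<in> rel M' R"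
  obtains Q :: "('v::infinite, 's) rel_structure"
    where "finite (verts Q)" "covered_by K Q" "\<And>M. M \<in> K \<Longrightarrow> \<exists>e. embedding e M Q"
proof -
  define P where "P = \<lparr>verts = Sigma K verts, rel = \<lambda>R. \<Union>M\<in>K. map (Pair M) ` rel M R\<rparr>"
  have emb: "embedding (Pair M) M P" if M: "M \<in> K" for M
    unfolding embedding_def
  proof (intro conjI allI impI)
    fix R xs assume xs: "set xs \<subseteq> verts M"
    have "xs \<in> rel M R" if N: "N \<in> K" and ys: "ys \<in> rel N R" and eq: "map (Pair M) xs = map (Pair N) ys"
      for N ys
    proof (cases xs)
      case Nil
      then show ?thesis using nullary[OF N M] ys eq by simp
    next
      case (Cons x xs')
      then have "M = N" using eq by (cases ys) auto
      moreover from this have "xs = ys" using eq by (auto simp: inj_map_eq_map inj_on_def)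
      ultimately show ?thesis using ys by simp
    qed
    then show "xs \<in> rel M R \<longleftrightarrow> map (Pair M) xs \<in> rel P R"
      using M by (auto simp: P_def)
  qed (use M in \<open>auto simp: P_def inj_on_def\<close>)
  have cov: "covered_by K P"
    unfolding covered_by_def
  proof (intro conjI ballI allI)
    fix v assume "v \<in> verts P"
    then show "\<exists>M\<in>K. \<exists>e. embedding e M P \<and> v \<in> e ` verts M"
      using emb by (fastforce simp: P_def)
  next
    fix R xs assume "xs \<in> rel P R"
    then obtain M us where "M \<in> K" "us \<in> rel M R" "xs = map (Pair M) us" by (auto simp: P_def)
    then show "\<exists>M\<in>K. \<exists>e us. embedding e M P \<and> us \<in> rel M R \<and> set us \<subseteq> verts M \<and> xs = map e us"
      using emb assms(3) unfolding well_formed_def by blast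
  qed
  have "finite (verts P)" using assms(1,2) by (simp add: P_def)
  then obtain Q :: "('v, 's) rel_structure" and h
    where Q: "finite (verts Q)" "covered_by {P} Q" "embedding h P Q"
    using exists_isomorphic_copy covered_by_well_formed[OF cov] by blast
  show ?thesis
    using that[OF Q(1) covered_by_trans[OF cov Q(2)]] embedding_comp[OF emb Q(3)] by blast
qed

section \<open>Finite linear orders\<close>

lemma strictly_monotone_exists:
  fixes lt :: "'p \<Rightarrow> 'p \<Rightarrow> bool"
  assumes fin: "finite S" and irr: "\<And>p. \<not> lt p p"
    and tr: "\<And>p q r. p \<in> S \<Longrightarrow> q \<in> S \<Longrightarrow> r \<in> S \<Longrightarrow> lt p q \<Longrightarrow> lt q r \<Longrightarrow> lt p r"
    and tot: "\<And>p q. p \<in> S \<Longrightarrow> q \<in> S \<Longrightarrow> p \<noteq> q \<Longrightarrow> lt p q \<or> lt q p"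
    and X: "finite X" "card X = card S"
  obtains \<kappa> :: "'p \<Rightarrow> nat"
    where "\<And>p q. p \<in> S \<Longrightarrow> q \<in> S \<Longrightarrow> lt p q \<Longrightarrow> \<kappa> p < \<kappa> q" "\<kappa> ` S = X"
proof -
  \<comment> \<open>Compose the rank function, which is onto an initial segment, with the enumeration of X.\<close>
  define rank where "rank p = card {q\<in>S. lt q p}" for p
  have mono: "rank p < rank q" if "p \<in> S" "q \<in> S" "lt p q" for p q
  proof -
    have "{r\<in>S. lt r p} \<subset> {r\<in>S. lt r q}" using that tr irr by blast
    then show ?thesis unfolding rank_def using fin by (simp add: psubset_card_mono)
  qed
  have "rank p < card S" if "p \<in> S" for p
  proof -
    have "{r\<in>S. lt r p} \<subset> S" using that irr by blast
    then show ?thesis unfolding rank_def using fin by (simp add: psubset_card_mono)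
  qed
  then have "rank ` S \<subseteq> {..<card S}" by auto
  moreover have "inj_on rank S" using mono tot by (metis inj_onI less_irrefl)
  ultimately have surj: "rank ` S = {..<card S}"
    by (intro card_subset_eq) (auto simp: card_image)
  obtain h where h: "bij_betw h {..<card X} X" "strict_mono_on {..<card X} h"
    using ex_bij_betw_strict_mono_card[OF X(1)] .
  have "h (rank p) < h (rank q)" if "p \<in> S" "q \<in> S" "lt p q" for p q
  proof (rule strict_mono_onD[OF h(2) _ _ mono[OF that]])
    show "rank p \<in> {..<card X}" "rank q \<in> {..<card X}" using surj that X(2) by auto
  qed
  moreover have "(\<lambda>p. h (rank p)) ` S = X"
    using bij_betw_imp_surj_on[OF h(1)] surj X(2) by (simp flip: image_image)
  ultimately show ?thesis using that[of "\<lambda>p. h (rank p)"] by simp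
qed

text \<open>
  The value at \<open>p\<close> is the element of the common image that has as many elements of the image below it as
  there are points below \<open>p\<close>.
\<close>

lemma strictly_monotone_unique:
  fixes lt :: "'p \<Rightarrow> 'p \<Rightarrow> bool" and \<kappa> \<mu> :: "'p \<Rightarrow> nat"
  assumes fin: "finite S"
    and tot: "\<And>p q. p \<in> S \<Longrightarrow> q \<in> S \<Longrightarrow> p \<noteq> q \<Longrightarrow> lt p q \<or> lt q p"
    and \<kappa>: "\<And>p q. p \<in> S \<Longrightarrow> q \<in> S \<Longrightarrow> lt p q \<Longrightarrow> \<kappa> p < \<kappa> q"
    and \<mu>: "\<And>p q. p \<in> S \<Longrightarrow> q \<in> S \<Longrightarrow> lt p q \<Longrightarrow> \<mu> p < \<mu> q"
    and same: "\<kappa> ` S = \<mu> ` S" and p: "p \<in> S"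
  shows "\<kappa> p = \<mu> p"
proof -
  have count: "card {y \<in> \<nu> ` S. y < \<nu> p} = card {q\<in>S. lt q p}"
    if \<nu>: "\<And>p q. p \<in> S \<Longrightarrow> q \<in> S \<Longrightarrow> lt p q \<Longrightarrow> \<nu> p < \<nu> q" for \<nu> :: "'p \<Rightarrow> nat"
  proof -
    have less_iff: "lt q r \<longleftrightarrow> \<nu> q < \<nu> r" if "q \<in> S" "r \<in> S" for q r
      using that tot[OF that] \<nu> by (metis less_asym)
    then have "inj_on \<nu> S" using tot by (metis inj_onI less_irrefl)
    then have "inj_on \<nu> {q\<in>S. lt q p}" by (rule inj_on_subset) blast
    moreover have "{y \<in> \<nu> ` S. y < \<nu> p} = \<nu> ` {q\<in>S. lt q p}" using less_iff p by auto
    ultimately show ?thesis by (simp add: card_image)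
  qed
  have *: "\<not> a < b" if "a \<in> Y" "card {y\<in>Y. y < a} = card {y\<in>Y. y < b}" "finite Y"
    for a b :: nat and Y
  proof
    assume "a < b"
    then have "{y\<in>Y. y < a} \<subset> {y\<in>Y. y < b}" using that(1) by auto
    then have "card {y\<in>Y. y < a} < card {y\<in>Y. y < b}"
      using that(3) by (intro psubset_card_mono) auto
    then show False using that(2) by simp
  qed
  have eq: "card {y \<in> \<kappa> ` S. y < \<kappa> p} = card {y \<in> \<kappa> ` S. y < \<mu> p}"
    using count[of \<kappa>, OF \<kappa>] count[of \<mu>, OF \<mu>] same by simp
  have "\<mu> p \<in> \<kappa> ` S" using p same by blast
  then show ?thesis using *[OF _ eq] *[OF _ eq[symmetric]] p fin by (meson finite_imageI imageI nat_neq_iff)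
qed

lemma linear_order_refining:
  fixes lab :: "'t \<Rightarrow> nat"
  assumes "finite T"
  obtains r where "linear_order_on T r" "\<And>x y. x \<in> T \<Longrightarrow> y \<in> T \<Longrightarrow> lab x < lab y \<Longrightarrow> (x, y) \<in> r"
proof -
  obtain h :: "'t \<Rightarrow> nat" where h: "inj_on h T" using finite_imp_inj_to_nat_seg[OF assms] by blast
  define r where "r = {(x, y). x \<in> T \<and> y \<in> T \<and> (lab x < lab y \<or> lab x = lab y \<and> h x \<le> h y)}"
  have "linear_order_on T r"
    using h by (auto simp: order_on_defs r_def refl_on_def trans_def antisym_def total_on_def inj_on_def)
  then show ?thesis using that by (simp add: r_def)
qed

lemma linear_order_on_preimage:
  assumes r: "linear_order_on T r" and g: "g ` V \<subseteq> T" "inj_on g V"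
  shows "linear_order_on V {(u, v) \<in> V \<times> V. (g u, g v) \<in> r}"
proof -
  have "refl_on T r" "trans r" "antisym r" "total_on T r" using r by (simp_all add: order_on_defs)
  then have "refl_on V {(u, v) \<in> V \<times> V. (g u, g v) \<in> r}"
    "trans {(u, v) \<in> V \<times> V. (g u, g v) \<in> r}" "antisym {(u, v) \<in> V \<times> V. (g u, g v) \<in> r}"
    using g by (auto simp: refl_on_def intro!: transI antisymI dest: transD antisymD inj_onD)
  moreover have "total_on V {(u, v) \<in> V \<times> V. (g u, g v) \<in> r}"
    using \<open>total_on T r\<close> g unfolding total_on_def by (auto simp: inj_on_eq_iff image_subset_iff)
  ultimately show ?thesis by (auto simp: order_on_defs)
qed

section \<open>Vertices and tuples as sorted points\<close>

text \<open>
  The sort \<open>None\<close> holds the vertices as one-element tuples, the sort \<open>Some R\<close> the tuples of \<open>R\<close>. This treats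
  the vertex order and the tuple orders alike.
\<close>

definition sort_tuples :: "('v, 'r) ordered_structure \<Rightarrow> 'r option \<Rightarrow> 'v list set" where
  "sort_tuples A s = (case s of None \<Rightarrow> (\<lambda>v. [v]) ` verts A | Some R \<Rightarrow> rel A R)"

definition sort_le :: "('v, 'r) ordered_structure \<Rightarrow> 'r option \<Rightarrow> ('v list \<times> 'v list) set" where
  "sort_le A s = (case s of None \<Rightarrow> {([u], [v]) | u v. (u, v) \<in> vert_le A} | Some R \<Rightarrow> tuple_le A R)"

lemma sort_le_linear:
  assumes "totally_ordered_structure L ar A"
  shows "linear_order_on (sort_tuples A s) (sort_le A s)"
proof (cases s)
  case None
  have "linear_order_on (verts A) (vert_le A)"
    using assms by (simp add: totally_ordered_structure_def)
  then have "linear_order_on (sort_tuples A s)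
      {(xs, ys) \<in> sort_tuples A s \<times> sort_tuples A s. (hd xs, hd ys) \<in> vert_le A}"
    using None by (intro linear_order_on_preimage) (auto simp: sort_tuples_def inj_on_def)
  moreover have "vert_le A \<subseteq> verts A \<times> verts A"
    using assms by (simp add: totally_ordered_structure_def order_on_defs)
  then have "sort_le A s =
      {(xs, ys) \<in> sort_tuples A s \<times> sort_tuples A s. (hd xs, hd ys) \<in> vert_le A}"
    using None by (auto simp: sort_tuples_def sort_le_def image_iff)
  ultimately show ?thesis by simp
next
  case (Some R)
  show ?thesis
  proof (cases "R \<in> L")
    case True
    then show ?thesis
      using assms Some by (simp add: totally_ordered_structure_def sort_tuples_def sort_le_def)
  next
    case False
    then have "sort_tuples A s = {}" "sort_le A s = {}"
      using assms Some
      by (simp_all add: totally_ordered_structure_def is_structure_def sort_tuples_def sort_le_def)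
    then show ?thesis by simp
  qed
qed

lemma sort_le_in:
  assumes "totally_ordered_structure L ar A" "(xs, ys) \<in> sort_le A s"
  shows "xs \<in> sort_tuples A s" "ys \<in> sort_tuples A s"
  using sort_le_linear[OF assms(1), of s] assms(2) by (auto simp: order_on_defs)

lemma sort_tuples_wf:
  assumes "totally_ordered_structure L ar A" "xs \<in> sort_tuples A s"
  shows "set xs \<subseteq> verts A" "length xs = (case s of None \<Rightarrow> 1 | Some R \<Rightarrow> ar R)"
    "s \<in> insert None (Some ` L)"
proof -
  have "set xs \<subseteq> verts A \<and> length xs = (case s of None \<Rightarrow> 1 | Some R \<Rightarrow> ar R) \<and> s \<in> insert None (Some ` L)"
  proof (cases s)
    case None
    then show ?thesis using assms by (auto simp: sort_tuples_def)
  next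
    case (Some R)
    then have "R \<in> L" using assms
      by (auto simp: totally_ordered_structure_def is_structure_def sort_tuples_def)
    then show ?thesis using assms Some
      by (auto simp: totally_ordered_structure_def is_structure_def sort_tuples_def)
  qed
  then show "set xs \<subseteq> verts A" "length xs = (case s of None \<Rightarrow> 1 | Some R \<Rightarrow> ar R)"
    "s \<in> insert None (Some ` L)" by auto
qed

text \<open>
  The arity fixes where a concatenation of two tuples has to be cut.
\<close>

lemma Tuple_Le_append_iff:
  assumes A: "totally_ordered_structure L ar A" and len: "length xs = ar R"
  shows "xs @ ys \<in> TO_rel A (Tuple_Le R) \<longleftrightarrow> (xs, ys) \<in> tuple_le A R"
proof
  assume "xs @ ys \<in> TO_rel A (Tuple_Le R)"
  then obtain xs' ys' where *: "xs @ ys = xs' @ ys'" "(xs', ys') \<in> tuple_le A R" by auto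
  then have "length xs' = ar R"
    using sort_le_in(1)[OF A, of xs' ys' "Some R"] sort_tuples_wf(2)[OF A, of xs' "Some R"]
    by (simp add: sort_le_def)
  then show "(xs, ys) \<in> tuple_le A R" using * len by simp
qed auto

lemma TO_embedding_sort_tuples:
  assumes f: "embedding f (TO A) (TO B)" and xs: "set xs \<subseteq> verts A"
  shows "map f xs \<in> sort_tuples B s \<longleftrightarrow> xs \<in> sort_tuples A s"
proof (cases s)
  case None
  have "f ` verts A \<subseteq> verts B" using f by (simp add: embedding_def TO_def)
  then show ?thesis using xs None by (auto simp: sort_tuples_def image_iff map_eq_Cons_conv)
next
  case (Some R)
  then show ?thesis
    using embedding_rel_iff[OF f, of xs "Rel R"] xs by (simp add: TO_def sort_tuples_def)
qed

lemma TO_embedding_sort_le: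
  assumes A: "totally_ordered_structure L ar A" and B: "totally_ordered_structure L ar B"
    and f: "embedding f (TO A) (TO B)" and xs: "xs \<in> sort_tuples A s" and ys: "ys \<in> sort_tuples A s"
  shows "(map f xs, map f ys) \<in> sort_le B s \<longleftrightarrow> (xs, ys) \<in> sort_le A s"
proof (cases s)
  case None
  then obtain u v where uv: "xs = [u]" "ys = [v]" "u \<in> verts A" "v \<in> verts A"
    using xs ys by (auto simp: sort_tuples_def)
  then have "[f u, f v] \<in> TO_rel B Vert_Le \<longleftrightarrow> [u, v] \<in> TO_rel A Vert_Le"
    using embedding_rel_iff[OF f, of "[u, v]" Vert_Le] by (simp add: TO_def)
  then show ?thesis using None uv by (auto simp: sort_le_def image_iff)
next
  case (Some R)
  have "map f xs @ map f ys \<in> TO_rel B (Tuple_Le R) \<longleftrightarrow> xs @ ys \<in> TO_rel A (Tuple_Le R)"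
    using embedding_rel_iff[OF f, of "xs @ ys" "Tuple_Le R"] sort_tuples_wf(1)[OF A xs]
      sort_tuples_wf(1)[OF A ys] by (simp add: TO_def)
  then show ?thesis
    using Tuple_Le_append_iff[OF A] Tuple_Le_append_iff[OF B] sort_tuples_wf(2)[OF A xs] Some
    by (simp add: sort_le_def)
qed

lemma TO_embeddingI:
  assumes B: "totally_ordered_structure L ar B" and C: "totally_ordered_structure L ar C"
    and inj: "inj_on e (verts B)" and sub: "e ` verts B \<subseteq> verts C"
    and tup: "\<And>s xs. set xs \<subseteq> verts B \<Longrightarrow> map e xs \<in> sort_tuples C s \<longleftrightarrow> xs \<in> sort_tuples B s"
    and le: "\<And>s xs ys. xs \<in> sort_tuples B s \<Longrightarrow> ys \<in> sort_tuples B s \<Longrightarrow>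
        (map e xs, map e ys) \<in> sort_le C s \<longleftrightarrow> (xs, ys) \<in> sort_le B s"
  shows "embedding e (TO B) (TO C)"
proof -
  have "zs \<in> TO_rel B T \<longleftrightarrow> map e zs \<in> TO_rel C T" if zs: "set zs \<subseteq> verts B" for zs T
  proof (cases T)
    case (Rel R)
    then show ?thesis using tup[OF zs, of "Some R"] by (simp add: sort_tuples_def)
  next
    case Vert_Le
    have *: "(u, v) \<in> vert_le B \<longleftrightarrow> (e u, e v) \<in> vert_le C" if "u \<in> verts B" "v \<in> verts B" for u v
      using le[of "[u]" None "[v]"] that by (auto simp: sort_le_def sort_tuples_def image_iff)
    show ?thesis
    proof
      assume "zs \<in> TO_rel B T"
      then show "map e zs \<in> TO_rel C T" using Vert_Le * zs by auto
    next
      assume "map e zs \<in> TO_rel C T"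
      then obtain u v where "zs = [u, v]" "(e u, e v) \<in> vert_le C"
        using Vert_Le by (auto simp: map_eq_Cons_conv)
      then show "zs \<in> TO_rel B T" using Vert_Le * zs by auto
    qed
  next
    case (Tuple_Le R)
    show ?thesis
    proof
      assume "zs \<in> TO_rel B T"
      then obtain xs ys where z: "zs = xs @ ys" "(xs, ys) \<in> sort_le B (Some R)"
        using Tuple_Le by (auto simp: sort_le_def)
      then have "(map e xs, map e ys) \<in> sort_le C (Some R)"
        using le sort_le_in[OF B z(2)] by blast
      then show "map e zs \<in> TO_rel C T" using z(1) Tuple_Le by (auto simp: sort_le_def)
    next
      assume "map e zs \<in> TO_rel C T"
      then obtain xs ys where z: "zs = xs @ ys" "(map e xs, map e ys) \<in> sort_le C (Some R)"
        using Tuple_Le by (auto simp: sort_le_def map_eq_append_conv)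
      then have "xs \<in> sort_tuples B (Some R)" "ys \<in> sort_tuples B (Some R)"
        using tup sort_le_in[OF C z(2)] zs by auto
      then have "(xs, ys) \<in> sort_le B (Some R)" using le z(2) by blast
      then show "zs \<in> TO_rel B T" using z(1) Tuple_Le by (auto simp: sort_le_def)
    qed
  qed
  then show ?thesis using inj sub by (simp add: embedding_def TO_def)
qed

section \<open>Labellings\<close>

text \<open>
  Only nonempty tuples are labelled: the empty tuple is shared by all structures on whatever
  vertices, so it could not carry different labels in different copies.
\<close>

definition points :: "('v, 'r) ordered_structure \<Rightarrow> ('r option \<times> 'v list) set" where
  "points A = {(s, xs). xs \<in> sort_tuples A s \<and> xs \<noteq> []}"

text \<open>
  The function \<open>idx\<close> arranges the sorts one after the other. A single linear order on all points makes the
  one-dimensional Ramsey theorem suffice in place of a product version with one factor for each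
  sort.
\<close>

definition point_less ::
    "('r option \<Rightarrow> nat) \<Rightarrow> ('v, 'r) ordered_structure \<Rightarrow> 'r option \<times> 'v list \<Rightarrow> 'r option \<times> 'v list \<Rightarrow> bool"
  where "point_less idx A p q \<longleftrightarrow>
     idx (fst p) < idx (fst q) \<or>
     fst p = fst q \<and> snd p \<noteq> snd q \<and> (snd p, snd q) \<in> sort_le A (fst p)"

definition labelling ::
    "('r option \<Rightarrow> nat) \<Rightarrow> ('v, 'r) ordered_structure \<Rightarrow> ('r option \<times> 'v list \<Rightarrow> nat) \<Rightarrow> bool"
  where "labelling idx A \<kappa> \<longleftrightarrow>
     (\<forall>p\<in>points A. \<forall>q\<in>points A. point_less idx A p q \<longrightarrow> \<kappa> p < \<kappa> q)"

text \<open>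
  The label \<open>0\<close> of the empty tuple does not depend on \<open>\<kappa>\<close>.
\<close>

definition labelled ::
    "('v, 'r) ordered_structure \<Rightarrow> ('r option \<times> 'v list \<Rightarrow> nat) \<Rightarrow> ('v, 'r option \<times> nat) rel_structure"
  where "labelled A \<kappa> = \<lparr>verts = verts A,
     rel = \<lambda>(s, i). {xs \<in> sort_tuples A s. i = (if xs = [] then 0 else \<kappa> (s, xs))}\<rparr>"

lemma finite_points:
  assumes "finite L" "totally_ordered_structure L ar A" "finite (verts A)"
  shows "finite (points A)"
proof (rule finite_subset)
  let ?T = "\<lambda>s. {xs. set xs \<subseteq> verts A \<and> length xs = (case s of None \<Rightarrow> 1 | Some R \<Rightarrow> ar R)}"
  show "points A \<subseteq> Sigma (insert None (Some ` L)) ?T"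
    using sort_tuples_wf[OF assms(2)] by (fastforce simp: points_def)
  show "finite (Sigma (insert None (Some ` L)) ?T)"
    using assms(1,3) by (intro finite_SigmaI finite_lists_length_eq) auto
qed

lemma point_less_irrefl: "\<not> point_less idx A p p"
  by (simp add: point_less_def)

lemma point_less_trans:
  assumes "totally_ordered_structure L ar A" "point_less idx A p q" "point_less idx A q r"
  shows "point_less idx A p r"
proof -
  show ?thesis
  proof (cases "idx (fst p) < idx (fst q) \<or> idx (fst q) < idx (fst r)")
    case True
    then show ?thesis using assms(2,3) by (auto simp: point_less_def)
  next
    case False
    then have s: "fst p = fst q" "fst q = fst r" and pq: "snd p \<noteq> snd q" "(snd p, snd q) \<in> sort_le A (fst q)"
      and qr: "(snd q, snd r) \<in> sort_le A (fst q)"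
      using assms(2,3) by (auto simp: point_less_def)
    have "trans (sort_le A (fst q))" "antisym (sort_le A (fst q))"
      using sort_le_linear[OF assms(1), of "fst q"] by (simp_all add: order_on_defs)
    then have "(snd p, snd r) \<in> sort_le A (fst q)" "snd p \<noteq> snd r"
      using pq qr by (auto dest: transD antisymD)
    then show ?thesis using s by (simp add: point_less_def)
  qed
qed

lemma point_less_total:
  assumes A: "totally_ordered_structure L ar A" and idx: "inj_on idx (insert None (Some ` L))"
    and "p \<in> points A" "q \<in> points A" "p \<noteq> q"
  shows "point_less idx A p q \<or> point_less idx A q p"
proof -
  obtain s xs t ys where pq: "p = (s, xs)" "q = (t, ys)" by fastforce
  then have in_sorts: "xs \<in> sort_tuples A s" "ys \<in> sort_tuples A t" using assms(3,4) by (auto simp: points_def)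
  show ?thesis
  proof (cases "s = t")
    case True
    have "total_on (sort_tuples A s) (sort_le A s)"
      using sort_le_linear[OF A, of s] by (simp add: order_on_defs)
    then show ?thesis
      using True pq in_sorts assms(5) by (auto simp: point_less_def total_on_def)
  next
    case False
    then have "idx s \<noteq> idx t"
      using inj_on_eq_iff[OF idx sort_tuples_wf(3)[OF A in_sorts(1)]
          sort_tuples_wf(3)[OF A in_sorts(2)]] by simp
    then show ?thesis using pq by (auto simp: point_less_def)
  qed
qed

lemma labelling_inj:
  assumes "totally_ordered_structure L ar A" "inj_on idx (insert None (Some ` L))"
    and "labelling idx A \<kappa>"
  shows "inj_on \<kappa> (points A)"
  using point_less_total[OF assms(1,2)] assms(3) unfolding labelling_def
  by (metis inj_onI less_irrefl)

lemma labelling_exists: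
  assumes "finite L" "totally_ordered_structure L ar A" "finite (verts A)"
    and "inj_on idx (insert None (Some ` L))" "finite X" "card X = card (points A)"
  obtains \<kappa> where "labelling idx A \<kappa>" "\<kappa> ` points A = X"
proof (rule strictly_monotone_exists[of "points A" "point_less idx A" X])
  show "finite (points A)" using assms(1-3) by (rule finite_points)
  show "point_less idx A p r" if "point_less idx A p q" "point_less idx A q r" for p q r
    using assms(2) that by (rule point_less_trans)
  show "point_less idx A p q \<or> point_less idx A q p"
    if "p \<in> points A" "q \<in> points A" "p \<noteq> q" for p q
    using assms(2,4) that by (rule point_less_total)
  show thesis if "\<And>p q. p \<in> points A \<Longrightarrow> q \<in> points A \<Longrightarrow> point_less idx A p q \<Longrightarrow> \<kappa> p < \<kappa> q"
    and "\<kappa> ` points A = X" for \<kappa>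
    using that by (intro \<open>\<And>\<kappa>. labelling idx A \<kappa> \<Longrightarrow> \<kappa> ` points A = X \<Longrightarrow> thesis\<close>)
      (auto simp: labelling_def)
qed (use assms(5,6) in \<open>auto simp: point_less_irrefl\<close>)

lemma labelling_unique:
  assumes "finite L" "totally_ordered_structure L ar A" "finite (verts A)"
    and "inj_on idx (insert None (Some ` L))"
    and "labelling idx A \<kappa>" "labelling idx A \<mu>" "\<kappa> ` points A = \<mu> ` points A" "p \<in> points A"
  shows "\<kappa> p = \<mu> p"
  using strictly_monotone_unique[of "points A" "point_less idx A" \<kappa> \<mu>, OF finite_points[OF assms(1-3)]
      point_less_total[OF assms(2,4)]] assms(5-8)
  unfolding labelling_def by blast

lemma labelling_cong:
  "(\<And>p. p \<in> points A \<Longrightarrow> \<kappa> p = \<mu> p) \<Longrightarrow> labelling idx A \<kappa> \<longleftrightarrow> labelling idx A \<mu>"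
  by (simp add: labelling_def)

lemma labelled_cong:
  assumes "\<And>p. p \<in> points A \<Longrightarrow> \<kappa> p = \<mu> p"
  shows "labelled A \<kappa> = labelled A \<mu>"
proof -
  have "\<kappa> (s, xs) = \<mu> (s, xs)" if "xs \<in> sort_tuples A s" "xs \<noteq> []" for s xs
    using assms[of "(s, xs)"] that by (simp add: points_def)
  then show ?thesis unfolding labelled_def by (auto simp: fun_eq_iff)
qed

lemma labelled_well_formed:
  assumes "totally_ordered_structure L ar A"
  shows "well_formed (labelled A \<kappa>)"
  using sort_tuples_wf(1)[OF assms] unfolding well_formed_def by (force simp: labelled_def)

text \<open>
  An embedding maps points to points and keeps their order, so it transports labels backwards. With the
  transported labels it is an embedding of unordered labelled structures.
\<close>

lemma pullback_labelling:
  assumes A: "totally_ordered_structure L ar A" and B: "totally_ordered_structure L ar B"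
    and f: "embedding f (TO A) (TO B)" and \<kappa>: "labelling idx B \<kappa>"
  defines "\<phi> \<equiv> \<lambda>(s, xs). (s, map f xs)"
  shows "labelling idx A (\<kappa> \<circ> \<phi>)" and "\<phi> ` points A \<subseteq> points B"
    and "embedding f (labelled A (\<kappa> \<circ> \<phi>)) (labelled B \<kappa>)"
proof -
  have tup: "map f xs \<in> sort_tuples B s \<longleftrightarrow> xs \<in> sort_tuples A s" if "set xs \<subseteq> verts A" for s xs
    using TO_embedding_sort_tuples[OF f that] .
  have inj: "inj_on f (verts A)" and sub: "f ` verts A \<subseteq> verts B"
    using f by (simp_all add: embedding_def TO_def)
  show \<phi>: "\<phi> ` points A \<subseteq> points B"
    using tup sort_tuples_wf(1)[OF A] by (auto simp: \<phi>_def points_def)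
  show "labelling idx A (\<kappa> \<circ> \<phi>)"
    unfolding labelling_def
  proof (intro ballI impI)
    fix p q assume pq: "p \<in> points A" "q \<in> points A" "point_less idx A p q"
    obtain s xs t ys where st: "p = (s, xs)" "q = (t, ys)" by fastforce
    have in_sorts: "xs \<in> sort_tuples A s" "ys \<in> sort_tuples A t" using st pq by (auto simp: points_def)
    have "point_less idx B (\<phi> p) (\<phi> q)"
    proof (cases "idx s < idx t")
      case True
      then show ?thesis by (simp add: st \<phi>_def point_less_def)
    next
      case False
      then have *: "s = t" "xs \<noteq> ys" "(xs, ys) \<in> sort_le A s"
        using pq(3) by (auto simp: st point_less_def)
      then have "map f xs \<noteq> map f ys"
        using inj_on_map_eq_map[OF inj_on_subset[OF inj], of xs ys]
          sort_tuples_wf(1)[OF A in_sorts(1)] sort_tuples_wf(1)[OF A in_sorts(2)] by simp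
      then show ?thesis
        using * TO_embedding_sort_le[OF A B f] in_sorts by (simp add: st \<phi>_def point_less_def)
    qed
    then show "(\<kappa> \<circ> \<phi>) p < (\<kappa> \<circ> \<phi>) q" using \<kappa> \<phi> pq by (auto simp: labelling_def)
  qed
  show "embedding f (labelled A (\<kappa> \<circ> \<phi>)) (labelled B \<kappa>)"
    using inj sub tup by (auto simp: embedding_def labelled_def \<phi>_def)
qed

section \<open>From labelled to ordered structures\<close>

text \<open>
  Tuples with equal labels may be ordered arbitrarily: no embedded copy of a labelled structure contains
  two of them in the same sort.
\<close>

definition realises :: "('v, 'r) ordered_structure \<Rightarrow> ('v, 'r option \<times> nat) rel_structure \<Rightarrow> bool" where
  "realises C Q \<longleftrightarrow> verts C = verts Q \<and> (\<forall>s. sort_tuples C s = (\<Union>i. rel Q (s, i))) \<and>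
     (\<forall>s i j. \<forall>xs\<in>rel Q (s, i). \<forall>ys\<in>rel Q (s, j). i < j \<longrightarrow> (xs, ys) \<in> sort_le C s)"

text \<open>
  Two distinct tuples of \<open>B\<close> in one sort are both nonempty, since they have the same length, and hence carry
  distinct labels. So the order of their images is the order of their labels, which is the order
  in \<open>B\<close>.
\<close>

lemma realises_embedding:
  assumes B: "totally_ordered_structure L ar B" and C: "totally_ordered_structure L ar C"
    and \<kappa>: "labelling idx B \<kappa>" and e: "embedding e (labelled B \<kappa>) Q" and CQ: "realises C Q"
  shows "embedding e (TO B) (TO C)"
proof (rule TO_embeddingI[OF B C])
  show inj: "inj_on e (verts B)" and "e ` verts B \<subseteq> verts C"
    using e CQ by (auto simp: embedding_def labelled_def realises_def)
  have rel_iff: "map e xs \<in> rel Q (s, i) \<longleftrightarrow> xs \<in> sort_tuples B s \<and> i = (if xs = [] then 0 else \<kappa> (s, xs))"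
    if "set xs \<subseteq> verts B" for s xs i
    using embedding_rel_iff[OF e, of xs "(s, i)"] that by (simp add: labelled_def)
  show tup: "map e xs \<in> sort_tuples C s \<longleftrightarrow> xs \<in> sort_tuples B s" if "set xs \<subseteq> verts B" for s xs
    using CQ rel_iff[OF that] by (simp add: realises_def)
  show "(map e xs, map e ys) \<in> sort_le C s \<longleftrightarrow> (xs, ys) \<in> sort_le B s"
    if xs: "xs \<in> sort_tuples B s" and ys: "ys \<in> sort_tuples B s" for s xs ys
  proof -
    have B_lin: "linear_order_on (sort_tuples B s) (sort_le B s)"
      and C_lin: "linear_order_on (sort_tuples C s) (sort_le C s)"
      using sort_le_linear[OF B] sort_le_linear[OF C] by auto
    have sets: "set xs \<subseteq> verts B" "set ys \<subseteq> verts B"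
      using sort_tuples_wf(1)[OF B] xs ys by auto
    \<comment> \<open>One direction suffices by totality of the order of B and antisymmetry of the order of C.\<close>
    have step: "(map e xs, map e ys) \<in> sort_le C s"
      if "(xs, ys) \<in> sort_le B s" "xs \<noteq> ys" "xs \<in> sort_tuples B s" "ys \<in> sort_tuples B s"
        "set xs \<subseteq> verts B" "set ys \<subseteq> verts B" for xs ys
    proof -
      have "length xs = length ys" using sort_tuples_wf(2)[OF B] that by metis
      then have ne: "xs \<noteq> []" "ys \<noteq> []" using that(2) by auto
      then have "\<kappa> (s, xs) < \<kappa> (s, ys)"
        using \<kappa> that unfolding labelling_def by (auto simp: points_def point_less_def)
      moreover have "map e xs \<in> rel Q (s, \<kappa> (s, xs))" "map e ys \<in> rel Q (s, \<kappa> (s, ys))"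
        using rel_iff that ne by auto
      ultimately show ?thesis using CQ unfolding realises_def by blast
    qed
    show ?thesis
    proof (cases "xs = ys")
      case True
      then show ?thesis
        using B_lin C_lin xs tup[OF sets(1)] by (simp add: order_on_defs refl_on_def)
    next
      case False
      then have ne: "map e xs \<noteq> map e ys"
        using inj_on_map_eq_map[OF inj_on_subset[OF inj], of xs ys] sets by simp
      have anti: "antisym (sort_le B s)" "antisym (sort_le C s)"
        using B_lin C_lin by (simp_all add: order_on_defs)
      have "(xs, ys) \<in> sort_le B s \<or> (ys, xs) \<in> sort_le B s"
        using B_lin False xs ys by (auto simp: order_on_defs total_on_def)
      then show ?thesis
        using step[of xs ys] step[of ys xs] False ne xs ys sets anti by (metis antisymD)
    qed
  qed
qed

lemma label_unique:
  assumes "covered_by K Q" "K \<subseteq> range (labelled B)" "xs \<in> rel Q (s, i)" "xs \<in> rel Q (s, j)"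
  shows "i = j"
proof -
  obtain M e us where M: "M \<in> K" "embedding e M Q" "us \<in> rel M (s, i)" "set us \<subseteq> verts M" "xs = map e us"
    using assms(1,3) by (rule covered_by_relE)
  then have "us \<in> rel M (s, j)" using embedding_rel_iff[OF M(2,4)] assms(4) by simp
  then show ?thesis using M(1,3) assms(2) by (auto simp: labelled_def)
qed

lemma covered_by_labelled_sort:
  assumes B: "totally_ordered_structure L ar B" and "covered_by K Q" "K \<subseteq> range (labelled B)"
    and "xs \<in> rel Q (s, i)"
  shows "set xs \<subseteq> verts Q" "length xs = (case s of None \<Rightarrow> 1 | Some R \<Rightarrow> ar R)"
    "s \<in> insert None (Some ` L)"
proof -
  obtain M e us where M: "M \<in> K" "us \<in> rel M (s, i)" "xs = map e us"
    using assms(2,4) by (rule covered_by_relE)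
  then have "us \<in> sort_tuples B s" using assms(3) by (auto simp: labelled_def)
  then show "length xs = (case s of None \<Rightarrow> 1 | Some R \<Rightarrow> ar R)" "s \<in> insert None (Some ` L)"
    using sort_tuples_wf(2,3)[OF B] M(3) by auto
  show "set xs \<subseteq> verts Q"
    using covered_by_well_formed[OF assms(2)] assms(4) by (auto simp: well_formed_def)
qed

text \<open>
  The label of a tuple is well defined by the covering, and any linear order of each sort that refines
  the order of the labels will do.
\<close>

lemma realisation_exists:
  fixes Q :: "('v, 'r option \<times> nat) rel_structure"
  assumes B: "totally_ordered_structure L ar B" and cov: "covered_by K Q" "K \<subseteq> range (labelled B)"
    and fin: "finite (verts Q)"
  obtains C where "totally_ordered_structure L ar C" "realises C Q"
proof -
  note wf = covered_by_labelled_sort[OF B cov]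
  define T where "T s = (\<Union>i. rel Q (s, i))" for s
  define lab where "lab s xs = (THE i. xs \<in> rel Q (s, i))" for s xs
  have lab: "lab s xs = i" if "xs \<in> rel Q (s, i)" for s xs i
    unfolding lab_def using that label_unique[OF cov] by blast
  have "finite (T s)" for s
  proof (rule finite_subset)
    show "T s \<subseteq> {xs. set xs \<subseteq> verts Q \<and> length xs = (case s of None \<Rightarrow> 1 | Some R \<Rightarrow> ar R)}"
      using wf(1,2) unfolding T_def by blast
  qed (use fin in \<open>rule finite_lists_length_eq\<close>)
  then have "\<exists>r. linear_order_on (T s) r \<and>
      (\<forall>x\<in>T s. \<forall>y\<in>T s. lab s x < lab s y \<longrightarrow> (x, y) \<in> r)" for s
    using linear_order_refining[of "T s" "lab s"] by metis
  then obtain r where r: "\<And>s. linear_order_on (T s) (r s)"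
    "\<And>s x y. x \<in> T s \<Longrightarrow> y \<in> T s \<Longrightarrow> lab s x < lab s y \<Longrightarrow> (x, y) \<in> r s"
    by metis
  have T_None: "T None = (\<lambda>v. [v]) ` verts Q"
  proof (intro equalityI subsetI)
    fix xs assume "xs \<in> T None"
    then obtain i where "xs \<in> rel Q (None, i)" by (auto simp: T_def)
    then have "set xs \<subseteq> verts Q" "length xs = 1" using wf(1,2) by force+
    then show "xs \<in> (\<lambda>v. [v]) ` verts Q" by (auto simp: length_Suc_conv)
  next
    fix xs assume "xs \<in> (\<lambda>v. [v]) ` verts Q"
    then obtain v where v: "v \<in> verts Q" "xs = [v]" by blast
    obtain M e u where M: "M \<in> K" "embedding e M Q" "u \<in> verts M" "v = e u"
      using cov(1) v(1) by (rule covered_by_vertE)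
    obtain \<kappa> where "M = labelled B \<kappa>" using M(1) cov(2) by blast
    then have "[u] \<in> rel M (None, \<kappa> (None, [u]))"
      using M(3) by (simp add: labelled_def sort_tuples_def)
    then show "xs \<in> T None"
      using embedding_rel_iff[OF M(2), of "[u]"] M(3,4) v(2) by (auto simp: T_def)
  qed
  have r_in: "x \<in> T s \<and> y \<in> T s" if "(x, y) \<in> r s" for s x y
    using r(1)[of s] that by (auto simp: order_on_defs)
  define C :: "('v, 'r) ordered_structure" where
    "C = \<lparr>verts = verts Q, rel = \<lambda>R. T (Some R),
          vert_le = {(u, v). ([u], [v]) \<in> r None}, tuple_le = \<lambda>R. r (Some R)\<rparr>"
  have tuples: "sort_tuples C s = T s" for s
    using T_None by (cases s) (simp_all add: sort_tuples_def C_def)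
  have le: "sort_le C s = r s" for s
  proof (cases s)
    case None
    have "\<exists>u v. x = [u] \<and> y = [v]" if "(x, y) \<in> r None" for x y
      using r_in[OF that] T_None by auto
    then show ?thesis using None by (force simp: sort_le_def C_def)
  qed (simp add: sort_le_def C_def)
  have "linear_order_on (verts Q) {(u, v) \<in> verts Q \<times> verts Q. ([u], [v]) \<in> r None}"
    using r(1)[of None] by (rule linear_order_on_preimage) (simp_all add: T_None inj_on_def)
  moreover have "{(u, v) \<in> verts Q \<times> verts Q. ([u], [v]) \<in> r None} = {(u, v). ([u], [v]) \<in> r None}"
    using r_in[of _ _ None] T_None by auto
  ultimately have "linear_order_on (verts Q) {(u, v). ([u], [v]) \<in> r None}" by simp
  moreover have "is_structure L ar C"
    unfolding is_structure_def using wf(1,2,3)[of _ "Some _"] by (fastforce simp: C_def T_def)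
  moreover have "r (Some R) = {}" if "R \<notin> L" for R
  proof -
    have "T (Some R) = {}" using wf(3)[of _ "Some R"] that by (auto simp: T_def)
    then show ?thesis using r_in[of _ _ "Some R"] by auto
  qed
  ultimately have "totally_ordered_structure L ar C"
    using r(1) by (simp add: totally_ordered_structure_def C_def)
  moreover have "realises C Q"
    unfolding realises_def tuples le
  proof (intro conjI allI ballI impI)
    fix s and i j :: nat and xs ys assume *: "xs \<in> rel Q (s, i)" "ys \<in> rel Q (s, j)" "i < j"
    then show "(xs, ys) \<in> r s" using r(2)[of xs s ys] lab by (auto simp: T_def)
  qed (simp_all add: C_def T_def)
  ultimately show ?thesis using that by blast
qed

section \<open>Copies as images of embeddings\<close>

definition induced :: "('v, 's) rel_structure \<Rightarrow> 'v set \<Rightarrow> ('v, 's) rel_structure" where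
  "induced T S = \<lparr>verts = S, rel = \<lambda>R. {xs \<in> rel T R. set xs \<subseteq> S}\<rparr>"

lemma substructure_eq_induced: "substructure A T \<Longrightarrow> A = induced T (verts A)"
  by (auto simp: substructure_def induced_def fun_eq_iff intro!: rel_structure.equality)

lemma substructure_trans: "substructure A B \<Longrightarrow> substructure B C \<Longrightarrow> substructure A C"
  by (auto simp: substructure_def)

lemma substructure_embedding: "substructure A B \<Longrightarrow> embedding (\<lambda>v. v) A B"
  by (auto simp: substructure_def embedding_def)

lemma substructure_induced: "S \<subseteq> verts T \<Longrightarrow> substructure (induced T S) T"
  by (auto simp: substructure_def induced_def)

lemma embedding_inverse:
  assumes f: "embedding f A B" and onto: "f ` verts A = verts B"
  shows "embedding (inv_into (verts A) f) B A"
  unfolding embedding_def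
proof (intro conjI allI impI)
  show "inj_on (inv_into (verts A) f) (verts B)" using onto by (simp add: inj_on_inv_into)
  have inv: "inv_into (verts A) f y \<in> verts A" if "y \<in> verts B" for y
    using that onto by (metis inv_into_into)
  then show "inv_into (verts A) f ` verts B \<subseteq> verts A" by blast
  fix R ys assume ys: "set ys \<subseteq> verts B"
  let ?xs = "map (inv_into (verts A) f) ys"
  have "set ?xs \<subseteq> verts A" using ys inv by auto
  moreover have "map f ?xs = ys"
    using ys onto by (auto intro!: map_idI simp: f_inv_into_f)
  ultimately show "ys \<in> rel B R \<longleftrightarrow> ?xs \<in> rel A R" using embedding_rel_iff[OF f] by metis
qed

lemma embedding_onto_induced: "embedding f A T \<Longrightarrow> embedding f A (induced T (f ` verts A))"
  by (auto simp: embedding_def induced_def)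

lemma image_in_copies:
  assumes "embedding f A T"
  shows "induced T (f ` verts A) \<in> copies T A"
proof -
  have f: "embedding f A (induced T (f ` verts A))" using assms by (rule embedding_onto_induced)
  have onto: "f ` verts A = verts (induced T (f ` verts A))" by (simp add: induced_def)
  have inj: "inj_on f (verts A)" using assms by (simp add: embedding_def)
  have "inv_into (verts A) f ` verts (induced T (f ` verts A)) = verts A"
    using inj by (auto simp: induced_def image_image inv_into_f_f)
  then have "isomorphic (induced T (f ` verts A)) A"
    unfolding isomorphic_def using embedding_inverse[OF f onto] by blast
  moreover have "substructure (induced T (f ` verts A)) T"
    using assms by (intro substructure_induced) (simp add: embedding_def)
  ultimately show ?thesis by (simp add: copies_def)
qed

lemma copies_in_image:
  assumes h: "embedding h B T" and A': "A' \<in> copies (induced T (h ` verts B)) A"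
  obtains f where "embedding f A B" "verts A' = h ` f ` verts A" "A' \<in> copies T A"
proof -
  let ?B = "induced T (h ` verts B)"
  have sub: "substructure A' ?B" using A' by (simp add: copies_def)
  obtain g where g: "embedding g A' A" "g ` verts A' = verts A"
    using A' by (auto simp: copies_def isomorphic_def)
  have onto: "h ` verts B = verts ?B" by (simp add: induced_def)
  define g' where "g' = inv_into (verts A') g"
  define h' where "h' = inv_into (verts B) h"
  have g': "embedding g' A A'" unfolding g'_def using g by (rule embedding_inverse)
  have h': "embedding h' ?B B"
    unfolding h'_def using embedding_onto_induced[OF h] onto by (rule embedding_inverse)
  have f: "embedding (h' \<circ> ((\<lambda>v. v) \<circ> g')) A B"
    using embedding_comp[OF embedding_comp[OF g' substructure_embedding[OF sub]] h'] .
  have "inj_on g (verts A')" using g(1) by (simp add: embedding_def)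
  then have "g' ` verts A = verts A'"
    unfolding g'_def g(2)[symmetric] by (simp add: image_image inv_into_f_f cong: image_cong)
  moreover have "h (h' v) = v" if "v \<in> verts A'" for v
    using that sub onto unfolding h'_def substructure_def by (metis f_inv_into_f subsetD)
  then have "(\<lambda>v. h (h' v)) ` verts A' = verts A'" by simp
  ultimately have "verts A' = (\<lambda>v. h (h' v)) ` g' ` verts A" by simp
  then have "verts A' = h ` (h' \<circ> ((\<lambda>v. v) \<circ> g')) ` verts A" by (simp add: image_image)
  moreover have "A' \<in> copies T A"
    using A' substructure_trans[OF sub substructure_induced[of "h ` verts B" T]] h
    by (simp add: copies_def embedding_def)
  ultimately show ?thesis using that f by blast
qed

section \<open>The Ramsey property\<close>

text \<open>
  Extensionality makes this set finite.
\<close>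

definition bounded_labellings ::
    "('r option \<Rightarrow> nat) \<Rightarrow> ('v, 'r) ordered_structure \<Rightarrow> nat \<Rightarrow> ('r option \<times> 'v list \<Rightarrow> nat) set"
  where
  "bounded_labellings idx A N = {\<kappa> \<in> points A \<rightarrow>\<^sub>E {..<N}. labelling idx A \<kappa>}"

lemma ramsey_homogeneous:
  assumes "k \<ge> 1"
  obtains N where "\<And>\<chi> :: nat set \<Rightarrow> nat. \<forall>Y. \<chi> Y < k \<Longrightarrow>
     \<exists>X c. X \<subseteq> {..<N} \<and> card X = m \<and> c < k \<and> (\<forall>Y. Y \<subseteq> X \<longrightarrow> card Y = n \<longrightarrow> finite Y \<longrightarrow> \<chi> Y = c)"
proof -
  obtain N :: nat where N: "partn_lst {..<N} (replicate k m) n" using ramsey_full by blast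
  show ?thesis
  proof
    fix \<chi> :: "nat set \<Rightarrow> nat" assume "\<forall>Y. \<chi> Y < k"
    then have "\<chi> \<in> nsets {..<N} n \<rightarrow> {..<length (replicate k m)}" by simp
    then obtain c X where c: "c < k" and X: "X \<in> nsets {..<N} m" "\<chi> ` nsets X n \<subseteq> {c}"
      using N unfolding partn_lst_def monochromatic_def by fastforce
    then show "\<exists>X c. X \<subseteq> {..<N} \<and> card X = m \<and> c < k \<and>
        (\<forall>Y. Y \<subseteq> X \<longrightarrow> card Y = n \<longrightarrow> finite Y \<longrightarrow> \<chi> Y = c)"
      by (intro exI[of _ X] exI[of _ c]) (auto simp: nsets_def)
  qed
qed

text \<open>
  The partite construction makes the colour of a copy of \<open>A\<close> a function \<open>col\<close> of its labelling, hence of a set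
  of naturals, and Ramsey's theorem selects the labels \<open>X\<close> of a copy of \<open>B\<close> on which this function is
  constant.
\<close>

lemma ordered_structures_ramsey:
  fixes A B :: "('v::infinite, 'r) ordered_structure" and k :: nat
  assumes L: "finite L" and A: "totally_ordered_structure L ar A" "finite (verts A)"
    and B: "totally_ordered_structure L ar B" "finite (verts B)" and k: "k \<ge> 1"
  obtains C :: "('v, 'r) ordered_structure"
    where "totally_ordered_structure L ar C" "finite (verts C)"
      "\<And>\<chi>. \<forall>S. \<chi> S < k \<Longrightarrow> \<exists>h c. embedding h (TO B) (TO C) \<and> c < k \<and>
         (\<forall>f. embedding f (TO A) (TO B) \<longrightarrow> \<chi> (h ` f ` verts A) = c)"
proof -
  obtain idx :: "'r option \<Rightarrow> nat" where idx: "inj_on idx (insert None (Some ` L))"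
    using finite_imp_inj_to_nat_seg[of "insert None (Some ` L)"] L by blast
  obtain N where N: "\<And>\<chi> :: nat set \<Rightarrow> nat. \<forall>Y. \<chi> Y < k \<Longrightarrow>
     \<exists>X c. X \<subseteq> {..<N} \<and> card X = card (points B) \<and> c < k \<and>
       (\<forall>Y. Y \<subseteq> X \<longrightarrow> card Y = card (points A) \<longrightarrow> finite Y \<longrightarrow> \<chi> Y = c)"
    using ramsey_homogeneous[OF k] by blast
  define KA where "KA = labelled A ` bounded_labellings idx A N"
  define KB where "KB = labelled B ` bounded_labellings idx B N"
  have fin_bl: "finite (bounded_labellings idx D N)"
    if "totally_ordered_structure L ar D" "finite (verts D)" for D :: "('v, 'r) ordered_structure"
    unfolding bounded_labellings_def using finite_points[OF L that] by (simp add: finite_PiE)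
  have KB_sub: "KB \<subseteq> range (labelled B)" by (auto simp: KB_def)
  obtain Q0 :: "('v, 'r option \<times> nat) rel_structure"
    where Q0: "finite (verts Q0)" "covered_by KB Q0" "\<And>M. M \<in> KB \<Longrightarrow> \<exists>e. embedding e M Q0"
  proof (rule disjoint_union[of KB])
    show "finite KB" using fin_bl[OF B] by (simp add: KB_def)
    show "finite (verts M)" "well_formed M" if "M \<in> KB" for M
      using that B(2) labelled_well_formed[OF B(1)] by (auto simp: KB_def) (simp add: labelled_def)
    show "[] \<in> rel M' R" if "M \<in> KB" "M' \<in> KB" "[] \<in> rel M R" for M M' R
      using that by (auto simp: KB_def labelled_def split: prod.splits)
  qed blast
  have dist: "\<exists>U. distinguishes U M Q0" if M: "M \<in> KA" for M
  proof -
    obtain \<kappa> where \<kappa>: "M = labelled A \<kappa>" "labelling idx A \<kappa>"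
      using M by (auto simp: KA_def bounded_labellings_def)
    have "a = b" if "a \<in> verts A" "b \<in> verts A" "\<kappa> (None, [a]) = \<kappa> (None, [b])" for a b
      using labelling_inj[OF A(1) idx \<kappa>(2)] that
      by (auto simp: points_def sort_tuples_def dest: inj_onD)
    then have "distinguishes (\<lambda>a. (None, \<kappa> (None, [a]))) M Q0"
      using label_unique[OF Q0(2) KB_sub]
      by (auto simp: distinguishes_def \<kappa>(1) labelled_def sort_tuples_def)
    then show ?thesis by blast
  qed
  obtain Q :: "('v, 'r option \<times> nat) rel_structure"
    where Q: "finite (verts Q)" "covered_by {Q0} Q"
      "\<And>\<chi>. \<forall>S. \<chi> S < k \<Longrightarrow> \<exists>e. embedding e Q0 Q \<and>
         (\<forall>M\<in>KA. \<exists>c. \<forall>f. embedding f M Q0 \<longrightarrow> \<chi> (e ` f ` verts M) = c)"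
  proof (rule partite_construction[of KA Q0 k])
    show "finite KA" using fin_bl[OF A] by (simp add: KA_def)
    show "finite (verts M)" if "M \<in> KA" for M using that A(2) by (auto simp: KA_def labelled_def)
  qed (use Q0 dist covered_by_well_formed in blast)+
  obtain C where C: "totally_ordered_structure L ar C" "realises C Q"
    using realisation_exists[OF B(1) covered_by_trans[OF Q0(2) Q(2)] KB_sub Q(1)] .
  show ?thesis
  proof
    show "totally_ordered_structure L ar C" by (rule C(1))
    show "finite (verts C)" using C(2) Q(1) by (simp add: realises_def)
    fix \<chi> :: "'v set \<Rightarrow> nat" assume \<chi>: "\<forall>S. \<chi> S < k"
    obtain e where e: "embedding e Q0 Q"
      and "\<forall>M\<in>KA. \<exists>c. \<forall>f. embedding f M Q0 \<longrightarrow> \<chi> (e ` f ` verts M) = c"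
      using Q(3)[OF \<chi>] by blast
    then obtain col where col: "\<And>M f. M \<in> KA \<Longrightarrow> embedding f M Q0 \<Longrightarrow> \<chi> (e ` f ` verts M) = col M"
      by metis
    define lab where "lab Y = (SOME \<kappa>. \<kappa> \<in> bounded_labellings idx A N \<and> \<kappa> ` points A = Y)" for Y
    \<comment> \<open>The values of col are arbitrary for labellings of A without an embedding into Q0. Reduction
      modulo k keeps them in range and does not change the values that are colours of copies.\<close>
    have "\<forall>Y. col (labelled A (lab Y)) mod k < k" using k by simp
    then obtain X c where X: "X \<subseteq> {..<N}" "card X = card (points B)" and c: "c < k"
      "\<And>Y. Y \<subseteq> X \<Longrightarrow> card Y = card (points A) \<Longrightarrow> finite Y \<Longrightarrow> col (labelled A (lab Y)) mod k = c"
      using N[of "\<lambda>Y. col (labelled A (lab Y)) mod k"] by blast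
    have "finite X" using X(1) finite_subset by blast
    obtain \<mu>0 where \<mu>0: "labelling idx B \<mu>0" "\<mu>0 ` points B = X"
      using labelling_exists[OF L B idx \<open>finite X\<close> X(2)] .
    define \<mu> where "\<mu> = restrict \<mu>0 (points B)"
    have \<mu>: "labelling idx B \<mu>" "\<mu> ` points B = X"
      using \<mu>0 labelling_cong[of B \<mu> \<mu>0 idx] by (auto simp: \<mu>_def)
    then have "\<mu> \<in> bounded_labellings idx B N"
      using X(1) by (auto simp: bounded_labellings_def \<mu>_def)
    then obtain i where i: "embedding i (labelled B \<mu>) Q0" using Q0(3) by (auto simp: KB_def)
    define h where "h = e \<circ> i"
    have "embedding h (labelled B \<mu>) Q" unfolding h_def using i e by (rule embedding_comp)
    then have h: "embedding h (TO B) (TO C)"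
      using realises_embedding[OF B(1) C(1) \<mu>(1) _ C(2)] by blast
    have "\<chi> (h ` f ` verts A) = c" if f: "embedding f (TO A) (TO B)" for f
    proof -
      \<comment> \<open>The labels that the copy of A inherits from the copy of B.\<close>
      define \<phi> :: "'r option \<times> 'v list \<Rightarrow> 'r option \<times> 'v list" where "\<phi> = (\<lambda>(s, xs). (s, map f xs))"
      define \<nu> where "\<nu> = restrict (\<mu> \<circ> \<phi>) (points A)"
      note pb = pullback_labelling[OF A(1) B(1) f \<mu>(1), folded \<phi>_def]
      have \<nu>: "labelling idx A \<nu>"
        using pb(1) labelling_cong[of A \<nu> "\<mu> \<circ> \<phi>" idx] by (simp add: \<nu>_def)
      have img: "\<nu> ` points A \<subseteq> X" using pb(2) \<mu>(2) by (auto simp: \<nu>_def)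
      have bl: "\<nu> \<in> bounded_labellings idx A N"
        unfolding bounded_labellings_def
      proof (intro CollectI conjI PiE_I \<nu>)
        show "\<nu> p \<in> {..<N}" if "p \<in> points A" for p using img X(1) that by blast
      qed (simp add: \<nu>_def)
      have "\<exists>\<rho>. \<rho> \<in> bounded_labellings idx A N \<and> \<rho> ` points A = \<nu> ` points A"
        using bl by blast
      then have "lab (\<nu> ` points A) \<in> bounded_labellings idx A N \<and>
          lab (\<nu> ` points A) ` points A = \<nu> ` points A"
        unfolding lab_def by (rule someI_ex)
      then have "lab (\<nu> ` points A) p = \<nu> p" if "p \<in> points A" for p
        using labelling_unique[OF L A idx _ \<nu> _ that] by (simp add: bounded_labellings_def)
      then have eq: "labelled A (lab (\<nu> ` points A)) = labelled A \<nu>" by (rule labelled_cong)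
      have "card (\<nu> ` points A) = card (points A)"
        using labelling_inj[OF A(1) idx \<nu>] by (rule card_image)
      then have "col (labelled A \<nu>) mod k = c"
        using c(2)[OF img] finite_subset[OF img \<open>finite X\<close>] eq by simp
      moreover have "labelled A \<nu> = labelled A (\<mu> \<circ> \<phi>)" by (rule labelled_cong) (simp add: \<nu>_def)
      then have "embedding (i \<circ> f) (labelled A \<nu>) Q0" using embedding_comp[OF pb(3) i] by simp
      then have "\<chi> (e ` (i \<circ> f) ` verts (labelled A \<nu>)) = col (labelled A \<nu>)"
        using bl by (intro col) (auto simp: KA_def)
      then have "\<chi> (h ` f ` verts A) = col (labelled A \<nu>)"
        by (simp add: h_def labelled_def image_comp comp_assoc)
      ultimately show ?thesis using \<chi> by (metis mod_less)
    qed
    then show "\<exists>h c. embedding h (TO B) (TO C) \<and> c < k \<and>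
         (\<forall>f. embedding f (TO A) (TO B) \<longrightarrow> \<chi> (h ` f ` verts A) = c)"
      using h c(1) by blast
  qed
qed

theorem theorem4p46:
  fixes L :: "'r set" and ar :: "'r \<Rightarrow> nat"
  assumes "finite L"
  shows "ramsey_class (TO_class L ar :: ('v::infinite, 'r TO_symbol) rel_structure set)"
  unfolding ramsey_class_def
proof (intro ballI allI impI)
  fix A0 B0 :: "('v, 'r TO_symbol) rel_structure" and k :: nat
  assume "A0 \<in> TO_class L ar" "B0 \<in> TO_class L ar" and k: "1 \<le> k"
  then obtain A B :: "('v, 'r) ordered_structure"
    where A0: "A0 = TO A" and A: "totally_ordered_structure L ar A" "finite (verts A)"
      and B0: "B0 = TO B" and B: "totally_ordered_structure L ar B" "finite (verts B)"
    unfolding TO_class_def by blast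
  obtain C :: "('v, 'r) ordered_structure"
    where C: "totally_ordered_structure L ar C" "finite (verts C)"
      "\<And>\<chi>. \<forall>S. \<chi> S < k \<Longrightarrow> \<exists>h c. embedding h (TO B) (TO C) \<and> c < k \<and>
         (\<forall>f. embedding f (TO A) (TO B) \<longrightarrow> \<chi> (h ` f ` verts A) = c)"
    using ordered_structures_ramsey[OF assms A B k] by blast
  show "\<exists>C\<in>TO_class L ar. \<forall>P :: nat \<Rightarrow> ('v, 'r TO_symbol) rel_structure set.
      disjoint_family_on P {..<k} \<and> (\<Union>i<k. P i) = copies C A0 \<longrightarrow>
      (\<exists>B'\<in>copies C B0. \<exists>i<k. copies B' A0 \<subseteq> P i)"
  proof (rule bexI[of _ "TO C"], intro allI impI)
    show "TO C \<in> TO_class L ar" using C(1,2) by (auto simp: TO_class_def)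
    fix P :: "nat \<Rightarrow> ('v, 'r TO_symbol) rel_structure set"
    assume "disjoint_family_on P {..<k} \<and> (\<Union>i<k. P i) = copies (TO C) A0"
    then have P: "(\<Union>i<k. P i) = copies (TO C) (TO A)" by (simp add: A0)
    \<comment> \<open>A copy is determined by its vertex set, so the partition is a colouring of sets. The value 0 for
      the other sets is a legal colour because k is positive.\<close>
    define \<chi> where "\<chi> S = (if induced (TO C) S \<in> copies (TO C) (TO A)
      then SOME i. i < k \<and> induced (TO C) S \<in> P i else 0)" for S
    have colour: "\<chi> S < k \<and> induced (TO C) S \<in> P (\<chi> S)"
      if "induced (TO C) S \<in> copies (TO C) (TO A)" for S
    proof -
      have "\<exists>i. i < k \<and> induced (TO C) S \<in> P i" using that P by blast
      from someI_ex[OF this] show ?thesis using that by (simp add: \<chi>_def)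
    qed
    then have "\<forall>S. \<chi> S < k" using k by (auto simp: \<chi>_def)
    then obtain h c where h: "embedding h (TO B) (TO C)" and c: "c < k"
      and mono: "\<And>f. embedding f (TO A) (TO B) \<Longrightarrow> \<chi> (h ` f ` verts A) = c"
      using C(3) by blast
    let ?B = "induced (TO C) (h ` verts (TO B))"
    have "A' \<in> P c" if A': "A' \<in> copies ?B (TO A)" for A'
    proof -
      obtain f where f: "embedding f (TO A) (TO B)" "verts A' = h ` f ` verts (TO A)"
        "A' \<in> copies (TO C) (TO A)"
        using copies_in_image[OF h A'] .
      have "A' = induced (TO C) (verts A')"
        using f(3) by (intro substructure_eq_induced) (simp add: copies_def)
      then show ?thesis using colour[of "verts A'"] f mono[OF f(1)] by (simp add: TO_def)
    qed
    then show "\<exists>B'\<in>copies (TO C) B0. \<exists>i<k. copies B' A0 \<subseteq> P i"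
      using image_in_copies[OF h] c by (auto simp: A0 B0)
  qed
qed

end
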